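(* For every matroid $M$: (1) the branch-depth of $M$ is at most $\mathrm{cdd}(M)$; (2) $\mathrm{cdd}(M)\le\min(\mathrm{cd}(M),\mathrm{dd}(M))$.
   Context: For a matroid $M$ with rank function $r$ on ground set $E$, the connectivity function is $\lambda_M(X)=r(X)+r(E\setminus X)-r(E)$. A decomposition of $\lambda_M$ is a pair $(T,\sigma)$ with $T$ a tree having at least one internal node and $\sigma$ a bijection from $E$ to the leaves of $T$; for an internal node $v$ the components of $T-v$ induce a partition $\mathcal P_v$ of $E$ and the width of $v$ is $\max_{\mathcal P'\subseteq\mathcal P_v}\lambda_M(\bigcup_{X\in\mathcal P'}X)$; the width of $(T,\sigma)$ is the maximum width of an internal node, and its radius is the minimum $r$ such that some node of $T$ is within distance $r$ of all nodes. The branch-depth of $M$ is the minimum $k$ such that there is a decomposition of width $\le k$ and radius $\le k$ (and $0$ if $|E|<2$). Contraction depth $\mathrm{cd}$, deletion depth $\mathrm{dd}$ and contraction-deletion depth $\mathrm{cdd}$ are defined recursively: all are $0$ if $E(M)=\emptyset$; if $M$ is disconnected each is the maximum of the respective depth over components; if $M$ is connected and nonempty, $\mathrm{cd}(M)$ is the minimum $k$ with $\mathrm{cd}(M/e)\le k-1$ for some $e$, $\mathrm{dd}(M)$ the minimum $k$ with $\mathrm{dd}(M\setminus e)\le k-1$ for some $e$, and $\mathrm{cdd}(M)$ the minimum $k$ such that $\mathrm{cdd}(M\setminus e)\le k-1$ or $\mathrm{cdd}(M/e)\le k-1$ for some $e$. *)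

theory Defs
  imports "Graph_Theory.Digraph_Component"
begin

definition matroid_on :: "'a set \<Rightarrow> 'a set set \<Rightarrow> bool" where
  "matroid_on E I \<longleftrightarrow>
     finite E \<and> I \<subseteq> Pow E \<and> {} \<in> I \<and>
     (\<forall>X\<in>I. \<forall>Y\<subseteq>X. Y \<in> I) \<and>
     (\<forall>X\<in>I. \<forall>Y\<in>I. card X < card Y \<longrightarrow> (\<exists>y\<in>Y - X. insert y X \<in> I))"

typedef 'a matroid = "{(E :: 'a set, I). matroid_on E I}"
  by (rule exI[of _ "({}, {{}})"]) (auto simp: matroid_on_def)

setup_lifting type_definition_matroid

lift_definition ground :: "'a matroid \<Rightarrow> 'a set" is fst .

lift_definition indep :: "'a matroid \<Rightarrow> 'a set set" is snd .

lemma matroid_on_ground_indep: "matroid_on (ground M) (indep M)"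
  by transfer auto

lemma finite_ground [simp]: "finite (ground M)"
  using matroid_on_ground_indep[of M] by (simp add: matroid_on_def)

lemma matroid_onI:
  assumes "finite E" "\<And>X. X \<in> I \<Longrightarrow> X \<subseteq> E" "{} \<in> I"
    and "\<And>X Y. X \<in> I \<Longrightarrow> Y \<subseteq> X \<Longrightarrow> Y \<in> I"
    and "\<And>X Y. X \<in> I \<Longrightarrow> Y \<in> I \<Longrightarrow> card X < card Y \<Longrightarrow> \<exists>y\<in>Y - X. insert y X \<in> I"
  shows "matroid_on E I"
proof -
  have "I \<subseteq> Pow E" using assms(2) by blast
  moreover have "\<forall>X\<in>I. \<forall>Y\<subseteq>X. Y \<in> I" using assms(4) by blast
  ultimately show ?thesis using assms(1,3,5) unfolding matroid_on_def by simp
qed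

lemma matroid_onD:
  assumes "matroid_on E I"
  shows "finite E" "X \<in> I \<Longrightarrow> X \<subseteq> E" "{} \<in> I"
    and "X \<in> I \<Longrightarrow> Y \<subseteq> X \<Longrightarrow> Y \<in> I"
    and "X \<in> I \<Longrightarrow> Y \<in> I \<Longrightarrow> card X < card Y \<Longrightarrow> \<exists>y\<in>Y - X. insert y X \<in> I"
proof -
  show "finite E" "{} \<in> I" using assms by (simp_all add: matroid_on_def)
  show "X \<subseteq> E" if "X \<in> I" using assms that unfolding matroid_on_def by (meson PowD subsetD)
  show "Y \<in> I" if "X \<in> I" "Y \<subseteq> X" using assms that unfolding matroid_on_def by meson
  show "\<exists>y\<in>Y - X. insert y X \<in> I" if "X \<in> I" "Y \<in> I" "card X < card Y"
    using assms that unfolding matroid_on_def by meson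
qed

lemma matroid_on_restrict:
  assumes "matroid_on E I"
  shows "matroid_on (E \<inter> X) {Y \<in> I. Y \<subseteq> X}"
proof (rule matroid_onI)
  note d = matroid_onD[OF assms]
  show "finite (E \<inter> X)" "{} \<in> {Y \<in> I. Y \<subseteq> X}" using d(1,3) by auto
  show "Y \<subseteq> E \<inter> X" if "Y \<in> {Y \<in> I. Y \<subseteq> X}" for Y
    using d(2)[of Y] that by blast
  show "Z \<in> {Y \<in> I. Y \<subseteq> X}" if "Y \<in> {Y \<in> I. Y \<subseteq> X}" "Z \<subseteq> Y" for Y Z
    using d(4)[of Y Z] that by blast
  show "\<exists>y\<in>Z - Y. insert y Y \<in> {Y \<in> I. Y \<subseteq> X}"
    if "Y \<in> {Y \<in> I. Y \<subseteq> X}" "Z \<in> {Y \<in> I. Y \<subseteq> X}" "card Y < card Z" for Y Z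
    using d(5)[of Y Z] that by blast
qed

lift_definition restrict_to :: "'a matroid \<Rightarrow> 'a set \<Rightarrow> 'a matroid" is
  "\<lambda>(E, I) X. (E \<inter> X, {Y \<in> I. Y \<subseteq> X})"
  using matroid_on_restrict by (simp split: prod.splits)

definition delete :: "'a matroid \<Rightarrow> 'a \<Rightarrow> 'a matroid" where
  "delete M e = restrict_to M (ground M - {e})"

lemma matroid_on_contract:
  assumes "matroid_on E I"
  shows "matroid_on (E - {e})
    (if {e} \<in> I then {Y. Y \<subseteq> E - {e} \<and> insert e Y \<in> I} else {Y. Y \<subseteq> E - {e} \<and> Y \<in> I})"
proof (cases "{e} \<in> I")
  case True
  note d = matroid_onD[OF assms]
  have "matroid_on (E - {e}) {Y. Y \<subseteq> E - {e} \<and> insert e Y \<in> I}" (is "matroid_on _ ?J")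
  proof (rule matroid_onI)
    show "finite (E - {e})" "{} \<in> ?J" using d(1) True by auto
    show "X \<subseteq> E - {e}" if "X \<in> ?J" for X using that by blast
    show "Y \<in> ?J" if "X \<in> ?J" "Y \<subseteq> X" for X Y
      using d(4)[of "insert e X" "insert e Y"] that by blast
    show "\<exists>y\<in>Y - X. insert y X \<in> ?J" if XY: "X \<in> ?J" "Y \<in> ?J" "card X < card Y" for X Y
    proof -
      have "finite X" "finite Y" using XY d(1) by (auto intro: finite_subset)
      moreover have "e \<notin> X" "e \<notin> Y" using XY by auto
      ultimately have "card (insert e X) < card (insert e Y)" using XY by simp
      then obtain y where y: "y \<in> insert e Y - insert e X" "insert y (insert e X) \<in> I"
        using d(5)[of "insert e X" "insert e Y"] XY by blast
      have "insert y X \<in> ?J" using y XY by (auto simp: insert_commute)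
      thus ?thesis using y by blast
    qed
  qed
  thus ?thesis using True by simp
next
  case False
  have "Y \<subseteq> E - {e}" if "Y \<in> I" for Y
    using matroid_onD(2)[OF assms that] matroid_onD(4)[OF assms that, of "{e}"] False by blast
  hence J: "{Y. Y \<subseteq> E - {e} \<and> Y \<in> I} = I" by blast
  have "matroid_on (E - {e}) I"
    using matroid_onD[OF assms] \<open>\<And>Y. Y \<in> I \<Longrightarrow> Y \<subseteq> E - {e}\<close>
    by (intro matroid_onI) (simp_all del: Diff_insert)
  thus ?thesis using False J by simp
qed

text \<open>Contracting a loop is the same as deleting it.\<close>

lift_definition contract :: "'a matroid \<Rightarrow> 'a \<Rightarrow> 'a matroid" is
  "\<lambda>(E, I) e. (E - {e},
     if {e} \<in> I then {Y. Y \<subseteq> E - {e} \<and> insert e Y \<in> I} else {Y. Y \<subseteq> E - {e} \<and> Y \<in> I})"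
  by (clarsimp simp only: mem_Collect_eq prod.case split: prod.splits) (rule matroid_on_contract)

lemma ground_restrict_to [simp]: "ground (restrict_to M X) = ground M \<inter> X"
  by transfer auto

lemma ground_delete [simp]: "ground (delete M e) = ground M - {e}"
  by (auto simp: delete_def)

lemma ground_contract [simp]: "ground (contract M e) = ground M - {e}"
  by transfer auto

definition rk :: "'a matroid \<Rightarrow> 'a set \<Rightarrow> nat" where
  "rk M X = Max (card ` {Y \<in> indep M. Y \<subseteq> X})"

lemma indep_finite: "Y \<in> indep M \<Longrightarrow> finite Y"
  using matroid_on_ground_indep[of M] unfolding matroid_on_def by (meson PowD finite_subset subsetD)

lemma finite_indep [simp]: "finite (indep M)"
  using matroid_on_ground_indep[of M]
  by (auto simp: matroid_on_def intro: finite_subset)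

lemma indep_card_le_rk: "Y \<in> indep M \<Longrightarrow> Y \<subseteq> X \<Longrightarrow> card Y \<le> rk M X"
  unfolding rk_def by (intro Max_ge) auto

text \<open>By this inequality the natural-number subtraction in \<open>conn_fun\<close> below never truncates.\<close>

lemma rk_ground_le: "rk M (ground M) \<le> rk M X + rk M (ground M - X)"
proof -
  have sub: "Z \<in> indep M" if "Y \<in> indep M" "Z \<subseteq> Y" for Y Z
    using matroid_on_ground_indep[of M] that by (auto simp: matroid_on_def)
  have "{} \<in> indep M" using matroid_on_ground_indep[of M] by (auto simp: matroid_on_def)
  hence "rk M (ground M) \<in> card ` {Y \<in> indep M. Y \<subseteq> ground M}"
    unfolding rk_def by (intro Max_in) auto
  then obtain B where B: "B \<in> indep M" "B \<subseteq> ground M" "rk M (ground M) = card B" by auto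
  have "card B = card (B \<inter> X) + card (B - X)"
    using indep_finite[OF B(1)]
    by (subst card_Un_disjoint[symmetric]) (auto intro: arg_cong[of _ _ card])
  moreover have "card (B \<inter> X) \<le> rk M X" "card (B - X) \<le> rk M (ground M - X)"
    using B sub[OF B(1)] by (auto intro!: indep_card_le_rk)
  ultimately show ?thesis using B(3) by linarith
qed

definition conn_fun :: "'a matroid \<Rightarrow> 'a set \<Rightarrow> nat" where
  "conn_fun M X = rk M X + rk M (ground M - X) - rk M (ground M)"

text \<open>
  Connectedness is 2-connectedness in the sense of the connectivity function: no separator other
  than the empty set and the ground set. The components are the minimal nonempty separators; these
  are the classes of the relation of being equal or lying in a common circuit.
\<close>

definition separator :: "'a matroid \<Rightarrow> 'a set \<Rightarrow> bool" where
  "separator M X \<longleftrightarrow> X \<subseteq> ground M \<and> conn_fun M X = 0"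

definition matroid_connected :: "'a matroid \<Rightarrow> bool" where
  "matroid_connected M \<longleftrightarrow> (\<forall>X. separator M X \<longrightarrow> X = {} \<or> X = ground M)"

definition components :: "'a matroid \<Rightarrow> 'a set set" where
  "components M = {X. X \<noteq> {} \<and> separator M X \<and>
     (\<forall>Y\<subset>X. separator M Y \<longrightarrow> Y = {})}"

lemma component_psubset:
  "\<not> matroid_connected M \<Longrightarrow> X \<in> components M \<Longrightarrow> X \<subset> ground M"
  unfolding matroid_connected_def components_def separator_def by blast

lemma card_component_less:
  "\<not> matroid_connected M \<Longrightarrow> X \<in> components M \<Longrightarrow> card (ground M \<inter> X) < card (ground M)"
  using component_psubset[of M X] by (intro psubset_card_mono) auto

function contraction_depth :: "'a matroid \<Rightarrow> nat" where
  "contraction_depth M =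
     (if ground M = {} then 0
      else if \<not> matroid_connected M
        then Max ((\<lambda>X. contraction_depth (restrict_to M X)) ` components M)
      else (LEAST k. \<exists>e\<in>ground M. contraction_depth (contract M e) + 1 \<le> k))"
  by auto
termination
  by (relation "measure (\<lambda>M. card (ground M))")
    (auto simp: card_component_less card_gt_0_iff)

function deletion_depth :: "'a matroid \<Rightarrow> nat" where
  "deletion_depth M =
     (if ground M = {} then 0
      else if \<not> matroid_connected M
        then Max ((\<lambda>X. deletion_depth (restrict_to M X)) ` components M)
      else (LEAST k. \<exists>e\<in>ground M. deletion_depth (delete M e) + 1 \<le> k))"
  by auto
termination
  by (relation "measure (\<lambda>M. card (ground M))")
    (auto simp: card_component_less card_gt_0_iff)

function contraction_deletion_depth :: "'a matroid \<Rightarrow> nat" where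
  "contraction_deletion_depth M =
     (if ground M = {} then 0
      else if \<not> matroid_connected M
        then Max ((\<lambda>X. contraction_deletion_depth (restrict_to M X)) ` components M)
      else (LEAST k. \<exists>e\<in>ground M.
        contraction_deletion_depth (delete M e) + 1 \<le> k \<or>
        contraction_deletion_depth (contract M e) + 1 \<le> k))"
  by auto
termination
  by (relation "measure (\<lambda>M. card (ground M))")
    (auto simp: card_component_less card_gt_0_iff)

declare contraction_depth.simps [simp del]
  and deletion_depth.simps [simp del]
  and contraction_deletion_depth.simps [simp del]

text \<open>
  A finite simple graph is a \<^locale>\<open>pair_graph\<close>: each undirected edge is a pair of opposite arcs.
  Hence a closed walk of length 2 is not a cycle of the undirected graph and has to be excluded.
  (The constant \<^const>\<open>Digraph_Component.tree\<close> is not usable here: it forbids only directed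
  cycles, including those of length 2.)
\<close>

definition simple_tree :: "'v pair_pre_digraph \<Rightarrow> bool" where
  "simple_tree T \<longleftrightarrow> pair_graph T \<and> Digraph_Component.connected (with_proj T) \<and>
     \<not> (\<exists>p. pre_digraph.cycle (with_proj T) p \<and> length p \<ge> 3)"

definition tree_leaves :: "'v pair_pre_digraph \<Rightarrow> 'v set" where
  "tree_leaves T = {v \<in> pverts T. out_degree (with_proj T) v = 1}"

definition internal_nodes :: "'v pair_pre_digraph \<Rightarrow> 'v set" where
  "internal_nodes T = pverts T - tree_leaves T"

definition node_dist :: "'v pair_pre_digraph \<Rightarrow> 'v \<Rightarrow> 'v \<Rightarrow> nat" where
  "node_dist T u w = (LEAST n. \<exists>p. pre_digraph.awalk (with_proj T) u p w \<and> length p = n)"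

definition tree_radius :: "'v pair_pre_digraph \<Rightarrow> nat" where
  "tree_radius T = (LEAST r. \<exists>u\<in>pverts T. \<forall>w\<in>pverts T. node_dist T u w \<le> r)"

definition decomposition :: "'a matroid \<Rightarrow> 'v pair_pre_digraph \<Rightarrow> ('a \<Rightarrow> 'v) \<Rightarrow> bool" where
  "decomposition M T \<sigma> \<longleftrightarrow>
     simple_tree T \<and> internal_nodes T \<noteq> {} \<and> bij_betw \<sigma> (ground M) (tree_leaves T)"

text \<open>In the symmetric digraph \<open>T - v\<close> the strong components are the connected components.\<close>

definition node_partition ::
  "'a matroid \<Rightarrow> 'v pair_pre_digraph \<Rightarrow> ('a \<Rightarrow> 'v) \<Rightarrow> 'v \<Rightarrow> 'a set set" where
  "node_partition M T \<sigma> v =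
     (\<lambda>C. {e \<in> ground M. \<sigma> e \<in> C}) `
       pre_digraph.sccs_verts (pre_digraph.del_vert (with_proj T) v)"

definition node_width ::
  "'a matroid \<Rightarrow> 'v pair_pre_digraph \<Rightarrow> ('a \<Rightarrow> 'v) \<Rightarrow> 'v \<Rightarrow> nat" where
  "node_width M T \<sigma> v =
     Max ((\<lambda>\<P>. conn_fun M (\<Union>\<P>)) ` Pow (node_partition M T \<sigma> v))"

definition decomposition_width ::
  "'a matroid \<Rightarrow> 'v pair_pre_digraph \<Rightarrow> ('a \<Rightarrow> 'v) \<Rightarrow> nat" where
  "decomposition_width M T \<sigma> = Max (node_width M T \<sigma> ` internal_nodes T)"

text \<open>
  Every finite tree is isomorphic to one whose nodes are natural numbers, so quantifying over
  such trees loses no generality. If \<open>M\<close> has at least two elements, a star is a decomposition,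
  so the minimum is over a nonempty set.
\<close>

definition branch_depth :: "'a matroid \<Rightarrow> nat" where
  "branch_depth M =
     (if card (ground M) < 2 then 0
      else (LEAST k. \<exists>(T :: nat pair_pre_digraph) \<sigma>.
        decomposition M T \<sigma> \<and> decomposition_width M T \<sigma> \<le> k \<and> tree_radius T \<le> k))"

end

theory Submission
  imports Defs
begin

text \<open>
  By induction on the ground set, every matroid \<open>M\<close> with contraction-deletion depth \<open>k\<close> has a laminar
  family \<open>F\<close> of nonempty sets, containing all singletons, of height and width at most \<open>k\<close>, such that
  \<open>\<lambda>\<close> vanishes on all unions of maximal members. If \<open>M\<close> is disconnected, take the union of
  the families of its components, since \<open>\<lambda>\<close> is bounded by the sum of its values on the components.
  If \<open>M\<close> is connected, take the family of a suitable \<open>M - e\<close> or \<open>M / e\<close> and add \<open>{e}\<close> and the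
  ground set: removing one element lowers \<open>\<lambda>\<close> by at most one. Adding the ground set as
  a root, if it is not there already, turns \<open>F\<close> into a tree of radius at most \<open>k\<close>, where the new root
  has width zero. It is essential that the roots of the components stay separate until then: joining
  them at every disconnected minor would make the radius grow twice as fast.
\<close>

section \<open>Rank\<close>

lemma empty_indep [simp]: "{} \<in> indep M"
  using matroid_onD(3)[OF matroid_on_ground_indep] .

lemma indep_subset: "Y \<in> indep M \<Longrightarrow> Z \<subseteq> Y \<Longrightarrow> Z \<in> indep M"
  using matroid_onD(4)[OF matroid_on_ground_indep] .

lemma indep_augment:
  "X \<in> indep M \<Longrightarrow> Y \<in> indep M \<Longrightarrow> card X < card Y \<Longrightarrow> \<exists>y\<in>Y - X. insert y X \<in> indep M"
  using matroid_onD(5)[OF matroid_on_ground_indep] .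

lemma rk_attained: "\<exists>Y\<in>indep M. Y \<subseteq> X \<and> card Y = rk M X"
proof -
  have "rk M X \<in> card ` {Y \<in> indep M. Y \<subseteq> X}"
    unfolding rk_def by (rule Max_in) (auto intro: exI[of _ "{}"])
  then show ?thesis by auto
qed

lemma rk_leI: "(\<And>Y. Y \<in> indep M \<Longrightarrow> Y \<subseteq> X \<Longrightarrow> card Y \<le> n) \<Longrightarrow> rk M X \<le> n"
  using rk_attained[of M X] by metis

text \<open>While \<open>card I\<close> is below \<open>rk M X\<close>, augmenting from a maximum
  independent subset of \<open>X\<close> adds an element of \<open>X\<close>. The induction is on
  the deficiency \<open>rk M X - card I\<close>.\<close>

lemma extend_to_basis:
  assumes "I \<in> indep M" "I \<subseteq> X"
  shows "\<exists>J\<in>indep M. I \<subseteq> J \<and> J \<subseteq> X \<and> card J = rk M X"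
  using assms
proof (induction "rk M X - card I" arbitrary: I rule: less_induct)
  case less
  show ?case
  proof (cases "card I = rk M X")
    case True
    then show ?thesis using less.prems by (intro bexI[of _ I]) simp_all
  next
    case False
    then have lt: "card I < rk M X"
      using indep_card_le_rk[OF less.prems] by simp
    obtain B where B: "B \<in> indep M" "B \<subseteq> X" "card B = rk M X"
      using rk_attained[of M X] by blast
    obtain y where y: "y \<in> B - I" "insert y I \<in> indep M"
      using indep_augment[OF less.prems(1) B(1)] lt B(3) by auto
    have "card (insert y I) = Suc (card I)"
      using y(1) indep_finite[OF less.prems(1)] by simp
    moreover have "insert y I \<subseteq> X" using y(1) B(2) less.prems(2) by blast
    ultimately obtain J where "J \<in> indep M" "insert y I \<subseteq> J" "J \<subseteq> X" "card J = rk M X"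
      using less.hyps[of "insert y I"] y(2) lt by (metis diff_less_mono2 lessI)
    then show ?thesis by (intro bexI[of _ J]) simp_all
  qed
qed

lemma rk_mono: "X \<subseteq> Y \<Longrightarrow> rk M X \<le> rk M Y"
  by (rule rk_leI, rule indep_card_le_rk) simp_all

lemma rk_empty [simp]: "rk M {} = 0"
  using rk_attained[of M "{}"] by simp

text \<open>A maximum independent subset \<open>I\<close> of \<open>X \<inter> Y\<close> extends to
  one, \<open>J\<close>, of \<open>X \<union> Y\<close>. The independent sets
  \<open>J \<inter> X\<close> and \<open>J \<inter> Y\<close> cover \<open>J\<close> and both
  contain \<open>I\<close>, so their sizes add up to at least
  \<open>card J + card I\<close>.\<close>

lemma rk_submodular: "rk M (X \<union> Y) + rk M (X \<inter> Y) \<le> rk M X + rk M Y"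
proof -
  obtain I where I: "I \<in> indep M" "I \<subseteq> X \<inter> Y" "card I = rk M (X \<inter> Y)"
    using rk_attained by metis
  then obtain J where J: "J \<in> indep M" "I \<subseteq> J" "J \<subseteq> X \<union> Y" "card J = rk M (X \<union> Y)"
    using extend_to_basis[of I M "X \<union> Y"] by blast
  have fin: "finite J" using J(1) by (rule indep_finite)
  have "card J + card I \<le> card ((J \<inter> X) \<union> (J \<inter> Y)) + card ((J \<inter> X) \<inter> (J \<inter> Y))"
    using fin I(2) J(2,3) by (intro add_mono card_mono finite_UnI finite_Int) auto
  also have "\<dots> = card (J \<inter> X) + card (J \<inter> Y)"
    using card_Un_Int[of "J \<inter> X" "J \<inter> Y"] fin by simp
  also have "\<dots> \<le> rk M X + rk M Y"
    using indep_subset[OF J(1)] by (intro add_mono indep_card_le_rk) auto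
  finally show ?thesis using I(3) J(4) by simp
qed

lemma rk_singleton_le: "rk M {e} \<le> 1"
proof (rule rk_leI)
  fix Y assume "Y \<subseteq> {e}"
  then show "card Y \<le> 1" using card_mono[of "{e}" Y] by simp
qed

lemma rk_insert_le: "rk M (insert e X) \<le> rk M X + 1"
  using rk_submodular[of M "{e}" X] rk_singleton_le[of M e] by simp

section \<open>Rank in restrictions and contractions\<close>

lemma indep_restrict_to: "indep (restrict_to M Z) = {Y \<in> indep M. Y \<subseteq> Z}"
  by transfer auto

lemma rk_restrict_to: "X \<subseteq> Z \<Longrightarrow> rk (restrict_to M Z) X = rk M X"
  unfolding rk_def indep_restrict_to by (rule arg_cong[of _ _ "\<lambda>S. Max (card ` S)"]) auto

lemma indep_contract:
  "indep (contract M e) =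
     (if {e} \<in> indep M then {Y. Y \<subseteq> ground M - {e} \<and> insert e Y \<in> indep M}
      else {Y. Y \<subseteq> ground M - {e} \<and> Y \<in> indep M})"
  by transfer auto

lemma indep_subset_ground: "Y \<in> indep M \<Longrightarrow> Y \<subseteq> ground M"
  using matroid_onD(2)[OF matroid_on_ground_indep] .

text \<open>The familiar rank r(X \<union> e) - r(e) of a contraction, written additively to avoid
  subtraction of natural numbers. Loops are covered as well, with
  \<open>rk M {e} = 0\<close>.\<close>

lemma rk_contract:
  assumes "e \<notin> X"
  shows "rk (contract M e) X + rk M {e} = rk M (insert e X)"
proof (cases "{e} \<in> indep M")
  case True
  have 1: "rk M {e} = 1"
    using indep_card_le_rk[OF True order_refl] rk_singleton_le[of M e] by simp
  show ?thesis
  proof (rule antisym)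
    obtain Y where Y: "Y \<in> indep (contract M e)" "Y \<subseteq> X" "card Y = rk (contract M e) X"
      using rk_attained by metis
    with True have "insert e Y \<in> indep M" by (simp add: indep_contract)
    moreover have "card (insert e Y) = Suc (card Y)"
      using Y(1,2) assms indep_finite by (metis card_insert_disjoint subsetD)
    ultimately show "rk (contract M e) X + rk M {e} \<le> rk M (insert e X)"
      using indep_card_le_rk[of "insert e Y" M "insert e X"] Y(2,3) 1 by auto
  next
    obtain J where J: "J \<in> indep M" "{e} \<subseteq> J" "J \<subseteq> insert e X" "card J = rk M (insert e X)"
      using extend_to_basis[OF True, of "insert e X"] by auto
    have "insert e (J - {e}) = J" using J(2) by blast
    then have "J - {e} \<in> indep (contract M e)"
      using True J(1) indep_subset_ground[OF J(1)] by (auto simp: indep_contract)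
    moreover have "card J = Suc (card (J - {e}))"
      using card_Suc_Diff1[OF indep_finite[OF J(1)], of e] J(2) by simp
    moreover have "J - {e} \<subseteq> X" using J(3) by blast
    ultimately show "rk M (insert e X) \<le> rk (contract M e) X + rk M {e}"
      using indep_card_le_rk[of "J - {e}" "contract M e" X] J(4) 1 by auto
  qed
next
  case False
  \<comment> \<open>Here \<open>e\<close> is a loop and lies in no independent set, so neither
    contracting \<open>e\<close> nor adding it to \<open>X\<close> changes which sets are
    counted.\<close>
  then have e: "e \<notin> Y" if "Y \<in> indep M" for Y
    using indep_subset[OF that, of "{e}"] by blast
  then have "indep (contract M e) = indep M"
    using False indep_subset_ground by (auto simp: indep_contract)
  moreover have "{Y \<in> indep M. Y \<subseteq> insert e X} = {Y \<in> indep M. Y \<subseteq> X}"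
    using e by blast
  moreover have "{Y \<in> indep M. Y \<subseteq> {e}} = {{}}"
    using e by (auto simp: subset_singleton_iff)
  ultimately show ?thesis unfolding rk_def by simp
qed

section \<open>Connectivity\<close>

text \<open>Additive form of the definition: later estimates become linear arithmetic without
  truncated subtraction.\<close>

lemma conn_fun_add: "conn_fun M X + rk M (ground M) = rk M X + rk M (ground M - X)"
  using rk_ground_le[of M X] by (simp add: conn_fun_def)

lemma conn_fun_compl: "X \<subseteq> ground M \<Longrightarrow> conn_fun M (ground M - X) = conn_fun M X"
  by (simp add: conn_fun_def double_diff add.commute)

lemma conn_fun_empty [simp]: "conn_fun M {} = 0"
  by (simp add: conn_fun_def)

lemma conn_fun_ground [simp]: "conn_fun M (ground M) = 0"
  by (simp add: conn_fun_def)

text \<open>Let \<open>e \<in> X\<close>. Deletion lowers the rank of \<open>X\<close> by at most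
  one, keeps that of the complement, and does not raise the total rank. Contraction subtracts
  \<open>rk M {e}\<close> from the rank of \<open>X\<close> and from the total rank, and lowers the
  rank of the complement by at most \<open>rk M {e} \<le> 1\<close>.\<close>

lemma conn_fun_le_single_minor:
  assumes N: "N = delete M e \<or> N = contract M e" and e: "e \<in> ground M" and X: "X \<subseteq> ground M"
  shows "conn_fun M X \<le> conn_fun N (X - {e}) + 1"
proof -
  \<comment> \<open>Stated for a fresh \<open>X\<close>, so that the case
    \<open>e \<notin> X\<close> follows by applying it to the complement, on which \<lambda> has the
    same value.\<close>
  have *: "conn_fun M X \<le> conn_fun N (X - {e}) + 1" if "e \<in> X" "X \<subseteq> ground M" for X
  proof -
    have g: "ground N = ground M - {e}" using N by auto
    have c: "ground M - {e} - (X - {e}) = ground M - X" using that by auto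
    have lM: "conn_fun M X + rk M (ground M) = rk M X + rk M (ground M - X)"
      by (rule conn_fun_add)
    have lN: "conn_fun N (X - {e}) + rk N (ground M - {e}) =
        rk N (X - {e}) + rk N (ground M - X)"
      using conn_fun_add[of N "X - {e}"] unfolding g c .
    have ins: "insert e (X - {e}) = X" "insert e (ground M - {e}) = ground M"
      using that e by auto
    from N show ?thesis
    proof
      assume N: "N = delete M e"
      have "rk N Z = rk M Z" if "Z \<subseteq> ground M - {e}" for Z
        unfolding N delete_def using that by (rule rk_restrict_to)
      moreover have "rk M X \<le> rk M (X - {e}) + 1"
        using rk_insert_le[of M e "X - {e}"] ins by simp
      moreover have "rk M (ground M - {e}) \<le> rk M (ground M)" by (rule rk_mono) blast
      moreover have "X - {e} \<subseteq> ground M - {e}" "ground M - X \<subseteq> ground M - {e}"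
        using that by auto
      ultimately show ?thesis using lM lN by simp
    next
      assume N: "N = contract M e"
      have "rk N (X - {e}) + rk M {e} = rk M X"
        using rk_contract[of e "X - {e}" M] N ins by simp
      moreover have "rk N (ground M - {e}) + rk M {e} = rk M (ground M)"
        using rk_contract[of e "ground M - {e}" M] N ins by simp
      moreover have "rk N (ground M - X) + rk M {e} = rk M (insert e (ground M - X))"
        using rk_contract[of e "ground M - X" M] N that by simp
      moreover have "rk M (ground M - X) \<le> rk M (insert e (ground M - X))"
        by (rule rk_mono) blast
      ultimately show ?thesis using lM lN rk_singleton_le[of M e] by linarith
    qed
  qed
  show ?thesis
  proof (cases "e \<in> X")
    case True
    then show ?thesis using * X by simp
  next
    case False
    have g: "ground N = ground M - {e}" using N by auto
    have "ground M - X - {e} = ground N - (X - {e})" "X - {e} \<subseteq> ground N" using g X by auto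
    then show ?thesis
      using *[of "ground M - X"] False e X conn_fun_compl[of X M] conn_fun_compl[of "X - {e}" N]
      by simp
  qed
qed

section \<open>Separators and components\<close>

text \<open>A vanishing \<lambda> only says that the total rank splits along \<open>S\<close>; by
  submodularity the rank of every subset then splits too. In this form separators are easily
  intersected.\<close>

lemma separator_iff_rk_split:
  "separator M S \<longleftrightarrow> S \<subseteq> ground M \<and> (\<forall>Y \<subseteq> ground M. rk M Y = rk M (Y \<inter> S) + rk M (Y - S))"
proof (intro iffI conjI allI impI)
  assume S: "separator M S"
  then show "S \<subseteq> ground M" by (simp add: separator_def)
  fix Y assume Y: "Y \<subseteq> ground M"
  have E: "rk M (ground M) = rk M S + rk M (ground M - S)"
    using S conn_fun_add[of M S] by (simp add: separator_def)
  have s: "(Y \<union> S) \<union> (Y \<union> (ground M - S)) = ground M"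
    "(Y \<union> S) \<inter> (Y \<union> (ground M - S)) = Y" "(Y \<inter> S) \<union> (Y - S) = Y"
    "Y \<inter> (ground M - S) = Y - S" "(Y \<inter> S) \<inter> (Y - S) = {}"
    using Y \<open>S \<subseteq> ground M\<close> by auto
  \<comment> \<open>Adding the first three instances and cancelling the total rank by
    \<open>E\<close> gives one inequality; the last instance is subadditivity and gives the
    other.\<close>
  show "rk M Y = rk M (Y \<inter> S) + rk M (Y - S)"
    using rk_submodular[of M "Y \<union> S" "Y \<union> (ground M - S)", unfolded s] rk_submodular[of M Y S]
      rk_submodular[of M Y "ground M - S", unfolded s]
      rk_submodular[of M "Y \<inter> S" "Y - S", unfolded s] E rk_empty[of M]
    by linarith
next
  assume S: "S \<subseteq> ground M \<and> (\<forall>Y \<subseteq> ground M. rk M Y = rk M (Y \<inter> S) + rk M (Y - S))"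
  then have "rk M (ground M) = rk M (ground M \<inter> S) + rk M (ground M - S)" by blast
  moreover have "ground M \<inter> S = S" using S by blast
  ultimately show "separator M S" using conjunct1[OF S] by (simp add: separator_def conn_fun_def)
qed

lemma separator_rk_split:
  "separator M S \<Longrightarrow> Y \<subseteq> ground M \<Longrightarrow> rk M Y = rk M (Y \<inter> S) + rk M (Y - S)"
  using iffD1[OF separator_iff_rk_split] by blast

lemma separator_compl: "separator M S \<Longrightarrow> separator M (ground M - S)"
  by (simp add: separator_def conn_fun_compl)

text \<open>Split \<open>Y\<close> along \<open>S\<close> and then \<open>Y \<inter> S\<close> along
  \<open>T\<close>. The last two of the three resulting pieces recombine to
  \<open>Y - S \<inter> T\<close>, because that set also splits along \<open>S\<close>.\<close>

lemma separator_Int: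
  assumes "separator M S" "separator M T"
  shows "separator M (S \<inter> T)"
  unfolding separator_iff_rk_split
proof (intro conjI allI impI)
  show "S \<inter> T \<subseteq> ground M" using assms by (auto simp: separator_def)
  fix Y assume Y: "Y \<subseteq> ground M"
  have S: "rk M Z = rk M (Z \<inter> S) + rk M (Z - S)" if "Z \<subseteq> Y" for Z
    using Y that by (intro separator_rk_split[OF assms(1)]) blast
  have T: "rk M Z = rk M (Z \<inter> T) + rk M (Z - T)" if "Z \<subseteq> Y" for Z
    using Y that by (intro separator_rk_split[OF assms(2)]) blast
  have s: "(Y - S \<inter> T) \<inter> S = Y \<inter> S - T" "(Y - S \<inter> T) - S = Y - S"
    "Y \<inter> (S \<inter> T) = Y \<inter> S \<inter> T" by auto
  have "rk M Y = rk M (Y \<inter> S) + rk M (Y - S)" by (rule S) simp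
  moreover have "rk M (Y - S \<inter> T) = rk M (Y \<inter> S - T) + rk M (Y - S)"
    using S[of "Y - S \<inter> T"] unfolding s by blast
  moreover have "rk M (Y \<inter> S) = rk M (Y \<inter> S \<inter> T) + rk M (Y \<inter> S - T)" by (rule T) blast
  ultimately show "rk M Y = rk M (Y \<inter> (S \<inter> T)) + rk M (Y - S \<inter> T)"
    unfolding s(3) by linarith
qed

lemma separator_ground: "separator M (ground M)"
  by (simp add: separator_def)

lemma components_disjoint:
  assumes "C \<in> components M" "D \<in> components M" "C \<noteq> D"
  shows "C \<inter> D = {}"
proof -
  have "separator M (C \<inter> D)"
    using assms(1,2) by (intro separator_Int) (auto simp: components_def)
  moreover have "C \<inter> D \<subset> C \<or> C \<inter> D \<subset> D"
    using assms(3) by blast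
  ultimately show ?thesis
    using assms(1,2) by (auto simp: components_def)
qed

text \<open>A smallest separator \<open>S\<close> containing \<open>x\<close> is a component: a
  nonempty separator \<open>Y\<close> properly inside \<open>S\<close> either contains
  \<open>x\<close> or leaves \<open>x\<close> in the separator \<open>S - Y\<close>, and both are
  smaller than \<open>S\<close>.\<close>

lemma Union_components: "\<Union> (components M) = ground M"
proof
  show "\<Union> (components M) \<subseteq> ground M" by (auto simp: components_def separator_def)
next
  show "ground M \<subseteq> \<Union> (components M)"
  proof
    fix x assume x: "x \<in> ground M"
    define P where "P S \<longleftrightarrow> separator M S \<and> x \<in> S" for S
    have "P (ground M)" using x separator_ground by (simp add: P_def)
    then obtain S where S: "P S" and min: "\<And>T. P T \<Longrightarrow> card S \<le> card T"
      using ex_has_least_nat[of P "ground M" card] by blast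
    have fin: "finite S" using S by (auto simp: P_def separator_def intro: finite_subset)
    have "Y = {}" if Y: "Y \<subset> S" "separator M Y" for Y
    proof (rule ccontr)
      assume ne: "Y \<noteq> {}"
      have "x \<notin> Y"
        using min[of Y] psubset_card_mono[OF fin Y(1)] Y(2) by (auto simp: P_def)
      moreover have "separator M (S \<inter> (ground M - Y))"
        using S Y(2) by (intro separator_Int separator_compl) (auto simp: P_def)
      ultimately have "card S \<le> card (S \<inter> (ground M - Y))"
        using S x by (intro min) (auto simp: P_def)
      moreover have "S \<inter> (ground M - Y) \<subset> S" using Y(1) ne by blast
      then have "card (S \<inter> (ground M - Y)) < card S" by (rule psubset_card_mono[OF fin])
      ultimately show False by simp
    qed
    then have "S \<in> components M"
      using S by (auto simp: components_def P_def)
    then show "x \<in> \<Union> (components M)" using S by (auto simp: P_def)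
  qed
qed

lemma finite_components [simp]: "finite (components M)"
  by (rule finite_subset[of _ "Pow (ground M)"]) (auto simp: components_def separator_def)

lemma component_subset: "C \<in> components M \<Longrightarrow> C \<subseteq> ground M"
  by (auto simp: components_def separator_def)

lemma rk_UN_le: "finite I \<Longrightarrow> rk M (\<Union>i\<in>I. A i) \<le> (\<Sum>i\<in>I. rk M (A i))"
proof (induction rule: finite_induct)
  case (insert i I)
  then show ?case using rk_submodular[of M "A i" "\<Union>i\<in>I. A i"] by simp
qed simp

lemma rk_ground_eq_sum_components: "rk M (ground M) = (\<Sum>C\<in>components M. rk M C)"
proof -
  \<comment> \<open>Generalised to subfamilies so that the induction can split off one component at
    a time.\<close>
  have "rk M (\<Union> \<C>) = (\<Sum>C\<in>\<C>. rk M C)" if "finite \<C>" "\<C> \<subseteq> components M" for \<C>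
    using that
  proof (induction rule: finite_induct)
    case (insert C \<C>)
    have "D \<inter> C = {}" if "D \<in> \<C>" for D
      using components_disjoint[of D M C] insert.prems insert.hyps(2) that by blast
    then have s: "\<Union> (insert C \<C>) \<inter> C = C" "\<Union> (insert C \<C>) - C = \<Union> \<C>" by auto
    have C: "separator M C"
      using insert.prems by (simp add: components_def)
    have sub: "\<Union> (insert C \<C>) \<subseteq> ground M"
      using insert.prems Union_components[of M] by blast
    show ?case
      using separator_rk_split[OF C sub] insert unfolding s by simp
  qed simp
  from this[of "components M"] show ?thesis by (simp add: Union_components)
qed

text \<open>The total rank is exactly additive over the components, while the ranks of
  \<open>X\<close> and of its complement are at most the sums of the ranks of their traces.\<close>

lemma conn_fun_le_sum_components:
  assumes X: "X \<subseteq> ground M"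
  shows "conn_fun M X \<le> (\<Sum>C\<in>components M. conn_fun (restrict_to M C) (X \<inter> C))"
proof -
  have eq: "conn_fun (restrict_to M C) (X \<inter> C) + rk M C = rk M (X \<inter> C) + rk M (C - X)"
    if "C \<in> components M" for C
  proof -
    have "ground M \<inter> C = C" "C - X \<inter> C = C - X" using component_subset[OF that] by auto
    then show ?thesis
      using conn_fun_add[of "restrict_to M C" "X \<inter> C"] by (simp add: rk_restrict_to)
  qed
  have "(\<Sum>C\<in>components M. conn_fun (restrict_to M C) (X \<inter> C) + rk M C)
      = (\<Sum>C\<in>components M. rk M (X \<inter> C) + rk M (C - X))"
    by (intro sum.cong refl eq)
  moreover have "(\<Union>C\<in>components M. X \<inter> C) = X" "(\<Union>C\<in>components M. C - X) = ground M - X"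
    using X Union_components[of M] by auto
  then have "rk M X \<le> (\<Sum>C\<in>components M. rk M (X \<inter> C))"
    "rk M (ground M - X) \<le> (\<Sum>C\<in>components M. rk M (C - X))"
    using rk_UN_le[of "components M" M "\<lambda>C. X \<inter> C"] rk_UN_le[of "components M" M "\<lambda>C. C - X"]
    by simp_all
  ultimately show ?thesis
    using conn_fun_add[of M X] rk_ground_eq_sum_components[of M] by (simp add: sum.distrib)
qed

section \<open>Decomposition forests\<close>

definition laminar :: "'a set set \<Rightarrow> bool" where
  "laminar F \<longleftrightarrow> (\<forall>A\<in>F. \<forall>B\<in>F. A \<subseteq> B \<or> B \<subseteq> A \<or> A \<inter> B = {})"

text \<open>No member of \<open>F\<close> is cut by \<open>X\<close>. If \<open>F\<close> is finite
  and laminar and covers \<open>X\<close>, this means that \<open>X\<close> is a union of maximal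
  members of \<open>F\<close>.\<close>

definition saturated :: "'a set set \<Rightarrow> 'a set \<Rightarrow> bool" where
  "saturated F X \<longleftrightarrow> (\<forall>B\<in>F. B \<subseteq> X \<or> B \<inter> X = {})"

text \<open>
  Ordered by inclusion, the members of \<open>F\<close> are the nodes of a forest with the singletons as leaves.
  In the width condition at \<open>A\<close>, the saturated sets are exactly the unions of parts of the partition
  of the ground set that is cut out by removing the node \<open>A\<close>.
\<close>

definition decomposition_forest :: "'a matroid \<Rightarrow> nat \<Rightarrow> 'a set set \<Rightarrow> bool" where
  "decomposition_forest M k F \<longleftrightarrow>
     F \<subseteq> Pow (ground M) - {{}} \<and> laminar F \<and> (\<forall>x\<in>ground M. {x} \<in> F) \<and>
     (\<forall>A\<in>F. card {B \<in> F. A \<subseteq> B} \<le> k) \<and>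
     (\<forall>A\<in>F. 2 \<le> card A \<longrightarrow> (\<forall>X\<subseteq>ground M.
        saturated (insert (ground M - A) {B \<in> F. B \<subset> A}) X \<longrightarrow> conn_fun M X \<le> k)) \<and>
     (\<forall>X\<subseteq>ground M. saturated F X \<longrightarrow> conn_fun M X = 0)"

lemma decomposition_forestI:
  assumes "F \<subseteq> Pow (ground M) - {{}}" "laminar F" "\<forall>x\<in>ground M. {x} \<in> F"
    and "\<And>A. A \<in> F \<Longrightarrow> card {B \<in> F. A \<subseteq> B} \<le> k"
    and "\<And>A X. A \<in> F \<Longrightarrow> 2 \<le> card A \<Longrightarrow> X \<subseteq> ground M \<Longrightarrow>
      saturated (insert (ground M - A) {B \<in> F. B \<subset> A}) X \<Longrightarrow> conn_fun M X \<le> k"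
    and "\<And>X. X \<subseteq> ground M \<Longrightarrow> saturated F X \<Longrightarrow> conn_fun M X = 0"
  shows "decomposition_forest M k F"
  unfolding decomposition_forest_def by (intro conjI ballI allI impI assms)

lemma decomposition_forestD:
  assumes "decomposition_forest M k F"
  shows "B \<in> F \<Longrightarrow> B \<subseteq> ground M" "B \<in> F \<Longrightarrow> B \<noteq> {}" "laminar F"
    and "x \<in> ground M \<Longrightarrow> {x} \<in> F"
    and "A \<in> F \<Longrightarrow> card {B \<in> F. A \<subseteq> B} \<le> k"
    and "A \<in> F \<Longrightarrow> 2 \<le> card A \<Longrightarrow> X \<subseteq> ground M \<Longrightarrow>
      saturated (insert (ground M - A) {B \<in> F. B \<subset> A}) X \<Longrightarrow> conn_fun M X \<le> k"
    and "X \<subseteq> ground M \<Longrightarrow> saturated F X \<Longrightarrow> conn_fun M X = 0"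
  using assms unfolding decomposition_forest_def by (simp_all add: subset_iff)

lemma decomposition_forest_finite: "decomposition_forest M k F \<Longrightarrow> finite F"
  by (rule finite_subset[of _ "Pow (ground M)"]) (auto dest: decomposition_forestD(1))

lemma decomposition_forest_mono:
  "decomposition_forest M k F \<Longrightarrow> k \<le> l \<Longrightarrow> decomposition_forest M l F"
  unfolding decomposition_forest_def by (blast intro: order_trans)

lemma saturated_mono: "saturated F X \<Longrightarrow> G \<subseteq> F \<Longrightarrow> saturated G X"
  by (auto simp: saturated_def)

lemma laminarD: "laminar F \<Longrightarrow> A \<in> F \<Longrightarrow> B \<in> F \<Longrightarrow> A \<subseteq> B \<or> B \<subseteq> A \<or> A \<inter> B = {}"
  by (simp add: laminar_def)

text \<open>The new root lengthens every old chain by one, and returning from \<open>N\<close> to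
  \<open>M\<close> raises \<lambda> by at most one. At the new root the parts are the old maximal
  members and \<open>{e}\<close>; there \<lambda> vanishes in \<open>N\<close>, hence is at most one
  in \<open>M\<close>.\<close>

lemma decomposition_forest_single_minor:
  assumes N: "N = delete M e \<or> N = contract M e" and e: "e \<in> ground M"
    and F: "decomposition_forest N k F"
  shows "decomposition_forest M (Suc k) (insert (ground M) (insert {e} F))" (is "decomposition_forest _ _ ?G")
proof -
  have g: "ground N = ground M - {e}" using N by auto
  note FD = decomposition_forestD[OF F]
  have sub: "B \<subseteq> ground M - {e}" if "B \<in> F" for B using FD(1)[OF that] g by simp
  have 1: "?G \<subseteq> Pow (ground M) - {{}}"
    using sub FD(2) e by auto
  have 2: "laminar ?G"
    unfolding laminar_def
  proof (intro ballI)
    fix A B assume "A \<in> ?G" "B \<in> ?G"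
    then show "A \<subseteq> B \<or> B \<subseteq> A \<or> A \<inter> B = {}"
      using laminarD[OF FD(3), of A B] sub[of A] sub[of B] e by auto
  qed
  have 3: "\<forall>x\<in>ground M. {x} \<in> ?G"
    using FD(4) g by auto
  have 4: "card {B \<in> ?G. A \<subseteq> B} \<le> Suc k" if A: "A \<in> ?G" for A
  proof (cases "A \<in> F")
    case True
    have "{B \<in> ?G. A \<subseteq> B} \<subseteq> insert (ground M) {B \<in> F. A \<subseteq> B}"
      using sub[OF True] FD(2)[OF True] by auto
    moreover have "finite {B \<in> F. A \<subseteq> B}"
      using decomposition_forest_finite[OF F] by simp
    ultimately have "card {B \<in> ?G. A \<subseteq> B} \<le> card (insert (ground M) {B \<in> F. A \<subseteq> B})"
      by (intro card_mono) simp_all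
    also have "\<dots> \<le> Suc (card {B \<in> F. A \<subseteq> B})"
      using \<open>finite {B \<in> F. A \<subseteq> B}\<close> by (simp add: card_insert_if)
    finally show ?thesis using FD(5)[OF True] by simp
  next
    case False
    then have "{B \<in> ?G. A \<subseteq> B} \<subseteq> {ground M, {e}}"
      using A sub e by fastforce
    \<comment> \<open>Such a chain may have two members, so \<open>k\<close> must be positive: a
      member of \<open>F\<close> forces \<open>1 \<le> k\<close>. If \<open>F\<close> is empty, the
      ground set is \<open>{e}\<close> and the two candidates coincide.\<close>
    show ?thesis
    proof (cases "F = {}")
      case True
      then have "ground M = {e}" using FD(4) g e by auto
      then have "?G = {{e}}" using True by auto
      then have "card {B \<in> ?G. A \<subseteq> B} \<le> card {{e}}" by (intro card_mono) auto
      then show ?thesis by simp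
    next
      case False
      then obtain A' where A': "A' \<in> F" by blast
      have "A' \<in> {B \<in> F. A' \<subseteq> B}" using A' by simp
      then have "card {B \<in> F. A' \<subseteq> B} > 0"
        using decomposition_forest_finite[OF F] by (subst card_gt_0_iff) auto
      then have "1 \<le> k" using FD(5)[OF A'] by simp
      moreover have "card {B \<in> ?G. A \<subseteq> B} \<le> card {ground M, {e}}"
        using \<open>{B \<in> ?G. A \<subseteq> B} \<subseteq> {ground M, {e}}\<close> by (intro card_mono) simp_all
      moreover have "card {ground M, {e}} \<le> 2" by (simp add: card_insert_if)
      ultimately show ?thesis by linarith
    qed
  qed
  have 5: "conn_fun M X \<le> Suc k"
    if A: "A \<in> ?G" "2 \<le> card A" and X: "X \<subseteq> ground M"
      and sat: "saturated (insert (ground M - A) {B \<in> ?G. B \<subset> A}) X" for A X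
  proof -
    have X': "X - {e} \<subseteq> ground N" using X g by auto
    \<comment> \<open>Old members avoid \<open>e\<close>, and the part outside an old node
      \<open>A\<close> merely loses \<open>e\<close>; so deleting \<open>e\<close> from
      \<open>X\<close> preserves saturation.\<close>
    have "conn_fun N (X - {e}) \<le> k"
    proof (cases "A \<in> F")
      case True
      have "saturated (insert (ground N - A) {B \<in> F. B \<subset> A}) (X - {e})"
        unfolding saturated_def g
      proof
        fix B assume "B \<in> insert (ground M - {e} - A) {B \<in> F. B \<subset> A}"
        then consider "B = ground M - {e} - A" | "B \<in> F" "B \<subset> A" by blast
        then show "B \<subseteq> X - {e} \<or> B \<inter> (X - {e}) = {}"
        proof cases
          case 1
          have "ground M - A \<subseteq> X \<or> (ground M - A) \<inter> X = {}"
            using sat by (simp add: saturated_def)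
          then show ?thesis using 1 by blast
        next
          case 2
          then have "B \<subseteq> X \<or> B \<inter> X = {}" using sat by (simp add: saturated_def)
          then show ?thesis using sub[OF 2(1)] by blast
        qed
      qed
      then show ?thesis using FD(6)[OF True A(2) X'] by simp
    next
      case False
      \<comment> \<open>The leaf \<open>{e}\<close> is excluded by \<open>2 \<le> card A\<close>.
        All old members lie strictly below the new root, so the root condition of \<open>F\<close>
        applies.\<close>
      have "A = ground M" using A False by auto
      have "saturated F (X - {e})"
        unfolding saturated_def
      proof
        fix B assume B: "B \<in> F"
        then have "B \<subset> A" using sub[OF B] e \<open>A = ground M\<close> by blast
        then have "B \<subseteq> X \<or> B \<inter> X = {}" using sat B by (simp add: saturated_def)
        then show "B \<subseteq> X - {e} \<or> B \<inter> (X - {e}) = {}" using sub[OF B] by blast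
      qed
      then show ?thesis using FD(7)[OF X'] by simp
    qed
    then show ?thesis using conn_fun_le_single_minor[OF N e X] by simp
  qed
  have 6: "conn_fun M X = 0" if X: "X \<subseteq> ground M" and sat: "saturated ?G X" for X
  proof -
    have "ground M \<subseteq> X \<or> ground M \<inter> X = {}" using sat by (simp add: saturated_def)
    then have "X = ground M \<or> X = {}" using X by blast
    then show ?thesis by auto
  qed
  show ?thesis
    by (rule decomposition_forestI) (fact 1 2 3 4 5 6)+
qed

text \<open>Chains stay inside one component, so heights do not add up. At a node \<open>A\<close>
  inside \<open>C\<close> every other component lies outside \<open>A\<close>, hence is contained in
  or disjoint from \<open>X\<close>; only the term of \<open>C\<close> survives in the bound on
  \<lambda>. For the root condition all terms vanish.\<close>

lemma decomposition_forest_Union_components: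
  assumes F: "\<And>C. C \<in> components M \<Longrightarrow> decomposition_forest (restrict_to M C) k (F C)"
  shows "decomposition_forest M k (\<Union>C\<in>components M. F C)" (is "decomposition_forest _ _ ?G")
proof -
  have g: "ground (restrict_to M C) = C" if "C \<in> components M" for C
    using component_subset[OF that] by auto
  have sub: "B \<subseteq> C" "B \<noteq> {}" if "C \<in> components M" "B \<in> F C" for B C
    using decomposition_forestD(1,2)[OF F[OF that(1)] that(2)] g[OF that(1)] by simp_all
  have dj: "C = D" if "C \<in> components M" "D \<in> components M" "x \<in> C" "x \<in> D" for C D x
    using components_disjoint[OF that(1,2)] that(3,4) by blast
  have 1: "?G \<subseteq> Pow (ground M) - {{}}"
    using sub component_subset by fastforce
  have 2: "laminar ?G"
    unfolding laminar_def
  proof (intro ballI)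
    fix A B assume "A \<in> ?G" "B \<in> ?G"
    then obtain C D where C: "C \<in> components M" "A \<in> F C" and D: "D \<in> components M" "B \<in> F D"
      by blast
    show "A \<subseteq> B \<or> B \<subseteq> A \<or> A \<inter> B = {}"
    proof (cases "C = D")
      case True
      then show ?thesis using laminarD[OF decomposition_forestD(3)[OF F[OF C(1)]]] C D by simp
    next
      case False
      then have "C \<inter> D = {}" using components_disjoint[OF C(1) D(1)] by simp
      then show ?thesis using sub(1)[OF C] sub(1)[OF D] by blast
    qed
  qed
  have 3: "\<forall>x\<in>ground M. {x} \<in> ?G"
  proof
    fix x assume "x \<in> ground M"
    then obtain C where C: "C \<in> components M" "x \<in> C"
      using Union_components[of M] by blast
    then have "{x} \<in> F C" using decomposition_forestD(4)[OF F[OF C(1)], of x, unfolded g[OF C(1)]] by blast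
    then show "{x} \<in> ?G" using C(1) by blast
  qed
  have 4: "card {B \<in> ?G. A \<subseteq> B} \<le> k" if "A \<in> ?G" for A
  proof -
    obtain C where C: "C \<in> components M" "A \<in> F C" using \<open>A \<in> ?G\<close> by blast
    obtain x where x: "x \<in> A" using sub(2)[OF C] by blast
    have "B \<in> F C" if "B \<in> ?G" "A \<subseteq> B" for B
    proof -
      obtain D where D: "D \<in> components M" "B \<in> F D" using \<open>B \<in> ?G\<close> by blast
      then have "C = D" using dj[OF C(1) D(1), of x] sub(1)[OF C] sub(1)[OF D] x \<open>A \<subseteq> B\<close> by blast
      then show ?thesis using D by simp
    qed
    then have "{B \<in> ?G. A \<subseteq> B} = {B \<in> F C. A \<subseteq> B}" using C(1) by blast
    then show ?thesis using decomposition_forestD(5)[OF F[OF C(1)] C(2)] by simp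
  qed
  have 5: "conn_fun M X \<le> k"
    if A: "A \<in> ?G" "2 \<le> card A" and X: "X \<subseteq> ground M"
      and sat: "saturated (insert (ground M - A) {B \<in> ?G. B \<subset> A}) X" for A X
  proof -
    obtain C where C: "C \<in> components M" "A \<in> F C" using A by blast
    have AC: "A \<subseteq> C" by (rule sub(1)[OF C])
    have out: "ground M - A \<subseteq> X \<or> (ground M - A) \<inter> X = {}"
      using sat by (simp add: saturated_def)
    have zero: "conn_fun (restrict_to M D) (X \<inter> D) = 0" if D: "D \<in> components M" "D \<noteq> C" for D
    proof -
      have "D \<subseteq> ground M - A"
        using components_disjoint[OF D(1) C(1) D(2)] component_subset[OF D(1)] AC by blast
      then have "X \<inter> D = ground (restrict_to M D) \<or> X \<inter> D = {}"
        unfolding g[OF D(1)] using out by blast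
      then show ?thesis by (metis conn_fun_ground conn_fun_empty)
    qed
    have "saturated (insert (ground (restrict_to M C) - A) {B \<in> F C. B \<subset> A}) (X \<inter> C)"
      unfolding saturated_def g[OF C(1)]
    proof
      fix B assume "B \<in> insert (C - A) {B \<in> F C. B \<subset> A}"
      then have "B \<subseteq> C" "B \<subseteq> X \<or> B \<inter> X = {}"
        using sub(1)[OF C(1)] out component_subset[OF C(1)] sat C(1)
        by (auto simp: saturated_def)
      then show "B \<subseteq> X \<inter> C \<or> B \<inter> (X \<inter> C) = {}" by blast
    qed
    then have "conn_fun (restrict_to M C) (X \<inter> C) \<le> k"
      using decomposition_forestD(6)[OF F[OF C(1)] C(2) A(2), of "X \<inter> C"]
      unfolding g[OF C(1)] by blast
    moreover have "(\<Sum>D\<in>components M. conn_fun (restrict_to M D) (X \<inter> D)) =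
        conn_fun (restrict_to M C) (X \<inter> C)"
      using zero C(1) by (simp add: sum.remove[of _ C])
    ultimately show ?thesis using conn_fun_le_sum_components[OF X] by simp
  qed
  have 6: "conn_fun M X = 0" if X: "X \<subseteq> ground M" and sat: "saturated ?G X" for X
  proof -
    have "conn_fun (restrict_to M D) (X \<inter> D) = 0" if D: "D \<in> components M" for D
    proof -
      have "saturated (F D) (X \<inter> D)"
        unfolding saturated_def
      proof
        fix B assume B: "B \<in> F D"
        then have "B \<subseteq> X \<or> B \<inter> X = {}" using sat D by (auto simp: saturated_def)
        then show "B \<subseteq> X \<inter> D \<or> B \<inter> (X \<inter> D) = {}" using sub(1)[OF D B] by blast
      qed
      then show ?thesis using decomposition_forestD(7)[OF F[OF D], of "X \<inter> D"]
        unfolding g[OF D] by blast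
    qed
    then show ?thesis using conn_fun_le_sum_components[OF X] by simp
  qed
  show ?thesis
    by (rule decomposition_forestI) (fact 1 2 3 4 5 6)+
qed

section \<open>Induction along the recursion of the depth parameters\<close>

lemma decomposition_forest_empty: "ground M = {} \<Longrightarrow> decomposition_forest M k {}"
  by (auto simp: decomposition_forest_def laminar_def)

lemma components_nonempty: "ground M \<noteq> {} \<Longrightarrow> components M \<noteq> {}"
  using Union_components[of M] by auto

lemma cdd_component_le:
  assumes "\<not> matroid_connected M" "C \<in> components M"
  shows "contraction_deletion_depth (restrict_to M C) \<le> contraction_deletion_depth M"
proof -
  have "ground M \<noteq> {}" using component_subset[OF assms(2)] assms(2) by (auto simp: components_def)
  then show ?thesis
    using assms by (subst (2) contraction_deletion_depth.simps) simp
qed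

lemma cdd_connected_attained:
  assumes "ground M \<noteq> {}" "matroid_connected M"
  shows "\<exists>e\<in>ground M. contraction_deletion_depth (delete M e) + 1 \<le> contraction_deletion_depth M \<or>
    contraction_deletion_depth (contract M e) + 1 \<le> contraction_deletion_depth M"
proof -
  let ?P = "\<lambda>k. \<exists>e\<in>ground M. contraction_deletion_depth (delete M e) + 1 \<le> k \<or>
    contraction_deletion_depth (contract M e) + 1 \<le> k"
  have "contraction_deletion_depth M = (LEAST k. ?P k)"
    using assms by (subst contraction_deletion_depth.simps) simp
  moreover have "\<exists>k. ?P k" using assms(1) by blast
  ultimately show ?thesis using LeastI_ex[of ?P] by simp
qed

lemma cdd_connected_le:
  assumes "matroid_connected M" "e \<in> ground M"
    and "contraction_deletion_depth (delete M e) < k \<or> contraction_deletion_depth (contract M e) < k"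
  shows "contraction_deletion_depth M \<le> k"
proof -
  have "ground M \<noteq> {}" using assms(2) by blast
  then show ?thesis
    using assms by (subst contraction_deletion_depth.simps) (auto intro!: Least_le simp: Suc_le_eq)
qed

lemma card_minor_less: "e \<in> ground M \<Longrightarrow> card (ground M - {e}) < card (ground M)"
  by (rule card_Diff1_less[OF finite_ground])

lemma ex_decomposition_forest: "\<exists>F. decomposition_forest M (contraction_deletion_depth M) F"
proof (induction "card (ground M)" arbitrary: M rule: less_induct)
  case less
  show ?case
  proof (cases "ground M = {}")
    case True
    then show ?thesis using decomposition_forest_empty by blast
  next
    case ne: False
    show ?thesis
    proof (cases "matroid_connected M")
      case True
      obtain e where e: "e \<in> ground M"
        and "contraction_deletion_depth (delete M e) + 1 \<le> contraction_deletion_depth M \<or>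
          contraction_deletion_depth (contract M e) + 1 \<le> contraction_deletion_depth M"
        using cdd_connected_attained[OF ne True] by blast
      then obtain N where N: "N = delete M e \<or> N = contract M e"
        and le: "Suc (contraction_deletion_depth N) \<le> contraction_deletion_depth M"
        by auto
      have "card (ground N) < card (ground M)" using N card_minor_less[OF e] by auto
      then obtain F where "decomposition_forest N (contraction_deletion_depth N) F"
        using less by blast
      from decomposition_forest_single_minor[OF N e this] show ?thesis
        using decomposition_forest_mono[OF _ le] by blast
    next
      case False
      \<comment> \<open>The forests of the components are weakened to the common bound for
        \<open>M\<close>, so that their union has a single height and width bound.\<close>
      have "\<exists>F. decomposition_forest (restrict_to M C) (contraction_deletion_depth M) F"
        if C: "C \<in> components M" for C
      proof -
        have "card (ground (restrict_to M C)) < card (ground M)"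
          using card_component_less[OF False C] by simp
        then obtain F where
          "decomposition_forest (restrict_to M C) (contraction_deletion_depth (restrict_to M C)) F"
          using less by blast
        then show ?thesis using decomposition_forest_mono[OF _ cdd_component_le[OF False C]] by blast
      qed
      then obtain F where
        "\<And>C. C \<in> components M \<Longrightarrow> decomposition_forest (restrict_to M C) (contraction_deletion_depth M) (F C)"
        by metis
      then show ?thesis using decomposition_forest_Union_components by blast
    qed
  qed
qed

lemma cdd_disconnected_le:
  assumes "ground M \<noteq> {}" "\<not> matroid_connected M"
    and "\<And>C. C \<in> components M \<Longrightarrow> contraction_deletion_depth (restrict_to M C) \<le> k"
  shows "contraction_deletion_depth M \<le> k"
  using assms components_nonempty[of M] by (subst contraction_deletion_depth.simps) auto

text \<open>Contraction depth and deletion depth differ only in the operation of the connected case.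
  Keeping \<open>d\<close> abstract, known through its recursion equation, treats both in one
  induction.\<close>

lemma cdd_le_depth_parameter:
  fixes d :: "'a matroid \<Rightarrow> nat" and op :: "'a matroid \<Rightarrow> 'a \<Rightarrow> 'a matroid"
  assumes d: "\<And>M. d M = (if ground M = {} then 0
      else if \<not> matroid_connected M then Max ((\<lambda>X. d (restrict_to M X)) ` components M)
      else (LEAST k. \<exists>e\<in>ground M. d (op M e) + 1 \<le> k))"
    and op: "op = delete \<or> op = contract"
  shows "contraction_deletion_depth M \<le> d M"
proof (induction "card (ground M)" arbitrary: M rule: less_induct)
  case less
  show ?case
  proof (cases "ground M = {}")
    case True
    then show ?thesis by (subst contraction_deletion_depth.simps) simp
  next
    case ne: False
    show ?thesis
    proof (cases "matroid_connected M")
      case True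
      let ?P = "\<lambda>k. \<exists>e\<in>ground M. d (op M e) + 1 \<le> k"
      have "d M = (LEAST k. ?P k)" using d[of M] ne True by simp
      moreover have "\<exists>k. ?P k" using ne by blast
      ultimately have "?P (d M)" using LeastI_ex[of ?P] by simp
      then obtain e where e: "e \<in> ground M" "d (op M e) + 1 \<le> d M" by blast
      have "card (ground (op M e)) < card (ground M)" using op card_minor_less[OF e(1)] by auto
      then have "contraction_deletion_depth (op M e) < d M" using less[of "op M e"] e(2) by simp
      then show ?thesis using op by (intro cdd_connected_le[OF True e(1)]) auto
    next
      case False
      have max: "d M = Max ((\<lambda>X. d (restrict_to M X)) ` components M)" using d[of M] ne False by simp
      show ?thesis
      proof (rule cdd_disconnected_le[OF ne False])
        fix C assume C: "C \<in> components M"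
        have "contraction_deletion_depth (restrict_to M C) \<le> d (restrict_to M C)"
          using card_component_less[OF False C] by (intro less) simp
        also have "\<dots> \<le> d M" unfolding max using C by (intro Max_ge) simp_all
        finally show "contraction_deletion_depth (restrict_to M C) \<le> d M" .
      qed
    qed
  qed
qed

lemma cdd_le_cd: "contraction_deletion_depth M \<le> contraction_depth M"
  by (rule cdd_le_depth_parameter[where op = contract, OF contraction_depth.simps]) simp

lemma cdd_le_dd: "contraction_deletion_depth M \<le> deletion_depth M"
  by (rule cdd_le_depth_parameter[where op = delete, OF deletion_depth.simps]) simp

section \<open>Trees of laminar families\<close>

lemma pcas_append: "pcas u (p @ q) v \<longleftrightarrow> (\<exists>w. pcas u p w \<and> pcas w q v)"
  by (induction p arbitrary: u) auto

text \<open>Turns the distinct vertices of a cycle into distinct heads of its arcs.\<close>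

lemma pawalk_verts_conv: "pcas u p v \<Longrightarrow> pawalk_verts u p = u # map snd p"
  by (induction p arbitrary: u) auto

text \<open>Nodes are labels \<open>v\<close> standing for sets \<open>D v\<close>, since
  branch-depth quantifies over trees on natural numbers and not on sets. Having \<open>E\<close>
  among the sets makes the forest a single rooted tree.\<close>

locale laminar_tree =
  fixes V :: "'v set" and D :: "'v \<Rightarrow> 'a set" and E :: "'a set" and \<sigma> :: "'a \<Rightarrow> 'v"
  assumes finite_V: "finite V" and finite_E: "finite E" and card_E: "2 \<le> card E"
    and inj_D: "inj_on D V" and laminar_D: "laminar (D ` V)"
    and D_subset: "\<And>v. v \<in> V \<Longrightarrow> D v \<subseteq> E" and D_nonempty: "\<And>v. v \<in> V \<Longrightarrow> D v \<noteq> {}"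
    and root_ex: "E \<in> D ` V"
    and leaf: "\<And>x. x \<in> E \<Longrightarrow> \<sigma> x \<in> V" "\<And>x. x \<in> E \<Longrightarrow> D (\<sigma> x) = {x}"
begin

text \<open>The covering relation of inclusion, phrased with a least instead of a minimal strict
  superset: uniqueness is then immediate, and laminarity enters in the existence proof.\<close>

definition parent :: "'v \<Rightarrow> 'v \<Rightarrow> bool" where
  "parent u v \<longleftrightarrow> u \<in> V \<and> v \<in> V \<and> D u \<subset> D v \<and> (\<forall>w\<in>V. D u \<subset> D w \<longrightarrow> D v \<subseteq> D w)"

definition T :: "'v pair_pre_digraph" where
  "T = \<lparr>pverts = V, parcs = {(u, v). parent u v \<or> parent v u}\<rparr>"

lemma T_simps [simp]: "pverts T = V" "(u, v) \<in> parcs T \<longleftrightarrow> parent u v \<or> parent v u"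
  by (simp_all add: T_def)

lemma finite_D: "v \<in> V \<Longrightarrow> finite (D v)"
  using D_subset finite_E by (blast intro: finite_subset)

lemma D_laminar: "u \<in> V \<Longrightarrow> v \<in> V \<Longrightarrow> D u \<subseteq> D v \<or> D v \<subseteq> D u \<or> D u \<inter> D v = {}"
  using laminar_D by (simp add: laminar_def)

lemma D_eqD: "D u = D v \<Longrightarrow> u \<in> V \<Longrightarrow> v \<in> V \<Longrightarrow> u = v"
  using inj_D by (rule inj_onD)

lemma parent_unique: "parent u v \<Longrightarrow> parent u w \<Longrightarrow> v = w"
  by (rule D_eqD) (auto simp: parent_def)

text \<open>A strict superset of \<open>D u\<close> of smallest size is least: any two supersets
  share the nonempty set \<open>D u\<close> and are therefore comparable.\<close>

lemma parent_ex:
  assumes u: "u \<in> V" "D u \<noteq> E"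
  shows "\<exists>v. parent u v"
proof -
  define P where "P v \<longleftrightarrow> v \<in> V \<and> D u \<subset> D v" for v
  obtain r where "r \<in> V" "D r = E" using root_ex by auto
  then have "P r" using u D_subset[OF u(1)] by (auto simp: P_def)
  then obtain v where v: "P v" and min: "\<And>w. P w \<Longrightarrow> card (D v) \<le> card (D w)"
    using ex_has_least_nat[of P r "\<lambda>v. card (D v)"] by blast
  have "D v \<subseteq> D w" if w: "w \<in> V" "D u \<subset> D w" for w
  proof (rule ccontr)
    assume n: "\<not> D v \<subseteq> D w"
    have "D v \<inter> D w \<noteq> {}" using v w D_nonempty[OF u(1)] by (auto simp: P_def)
    then have "D w \<subset> D v" using D_laminar[of v w] n v w by (auto simp: P_def)
    then have "card (D w) < card (D v)"
      using v finite_D by (intro psubset_card_mono) (auto simp: P_def)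
    then show False using min[of w] w by (simp add: P_def)
  qed
  then have "parent u v" using v u(1) unfolding parent_def P_def by blast
  then show ?thesis by blast
qed

text \<open>Take a largest set containing \<open>x\<close> strictly below \<open>D v\<close>; the
  singleton of \<open>x\<close> is a candidate. Sets containing \<open>x\<close> are comparable by
  laminarity.\<close>

lemma child_ex:
  assumes v: "v \<in> V" "x \<in> D v" "D v \<noteq> {x}"
  shows "\<exists>c. parent c v \<and> x \<in> D c"
proof -
  define P where "P c \<longleftrightarrow> c \<in> V \<and> x \<in> D c \<and> D c \<subset> D v" for c
  have x: "x \<in> E" using v D_subset by blast
  then have "P (\<sigma> x)" using leaf[OF x] v by (auto simp: P_def)
  moreover have "card (D c) < Suc (card E)" if "P c" for c
    using that card_mono[OF finite_E D_subset[of c]] by (simp add: P_def)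
  ultimately obtain c where c: "P c" and max: "\<And>w. P w \<Longrightarrow> card (D w) \<le> card (D c)"
    using ex_has_greatest_nat[of P "\<sigma> x" "\<lambda>c. card (D c)" "Suc (card E)"] by auto
  have "D v \<subseteq> D w" if w: "w \<in> V" "D c \<subset> D w" for w
  proof (rule ccontr)
    assume n: "\<not> D v \<subseteq> D w"
    have "x \<in> D v \<inter> D w" using c w by (auto simp: P_def)
    then have "D w \<subset> D v" using D_laminar[OF v(1) w(1)] n by auto
    then have "P w" using w c by (auto simp: P_def)
    then have "card (D w) \<le> card (D c)" by (rule max)
    then show False using psubset_card_mono[OF finite_D[OF w(1)] w(2)] by simp
  qed
  then have "parent c v" "x \<in> D c" using c v(1) unfolding parent_def P_def by blast+
  then show ?thesis by blast
qed

section \<open>The tree property and the leaves\<close>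

lemma pair_graph_T: "pair_graph T"
proof unfold_locales
  show "finite (pverts T)" using finite_V by simp
  show "finite (parcs T)"
    by (rule finite_subset[of _ "V \<times> V"]) (auto simp: parent_def finite_V)
  show "symmetric (with_proj T)" by (auto simp: symmetric_def intro: symI)
qed (auto simp: parent_def T_def)

text \<open>The arcs induced on \<open>W\<close>: with \<open>W = V\<close> for connectedness of
  \<open>T\<close>, and with \<open>W = V - {v}\<close> for the components of
  \<open>T - v\<close>.\<close>

definition arcs_on :: "'v set \<Rightarrow> 'v rel" where
  "arcs_on W = {(u, v). u \<in> W \<and> v \<in> W \<and> (parent u v \<or> parent v u)}"

lemma arcs_on_V: "arcs_on V = parcs T"
  by (auto simp: arcs_on_def parent_def T_def)

lemma rtrancl_on_arcs_on_sym:
  "(u, v) \<in> rtrancl_on W (arcs_on W) \<Longrightarrow> (v, u) \<in> rtrancl_on W (arcs_on W)"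
proof -
  have "(arcs_on W)\<inverse> = arcs_on W" by (auto simp: arcs_on_def)
  then show "(u, v) \<in> rtrancl_on W (arcs_on W) \<Longrightarrow> (v, u) \<in> rtrancl_on W (arcs_on W)"
    using rtrancl_on_converseI by metis
qed

text \<open>Climb from \<open>w\<close> to \<open>u\<close> along parents. The walk visits only sets
  between \<open>D w\<close> and \<open>D u\<close>, so only these nodes have to lie in
  \<open>W\<close>; this is how walks avoiding a removed node arise.\<close>

lemma rtrancl_on_ancestor:
  assumes "w \<in> V" "u \<in> V" "D w \<subseteq> D u"
    and "\<And>z. z \<in> V \<Longrightarrow> D w \<subseteq> D z \<Longrightarrow> D z \<subseteq> D u \<Longrightarrow> z \<in> W"
  shows "(w, u) \<in> rtrancl_on W (arcs_on W)"
  using assms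
proof (induction "card E - card (D w)" arbitrary: w rule: less_induct)
  case less
  have w: "w \<in> W" using less.prems by blast
  show ?case
  proof (cases "D w = D u")
    case True
    then show ?thesis using D_eqD less.prems(1,2) w by blast
  next
    case False
    then have ss: "D w \<subset> D u" using less.prems(3) by blast
    then have "D w \<noteq> E" using D_subset[OF less.prems(2)] by blast
    then obtain p where p: "parent w p" using parent_ex less.prems(1) by blast
    then have p': "p \<in> V" "D w \<subset> D p" "D p \<subseteq> D u"
      using ss less.prems(2) by (auto simp: parent_def)
    have "p \<in> W" using p' less.prems(4)[of p] by blast
    have "card (D w) < card (D p)"
      using p' finite_D by (intro psubset_card_mono) auto
    moreover have "card (D p) \<le> card E"
      using p' D_subset finite_E by (intro card_mono) auto
    ultimately have "card E - card (D p) < card E - card (D w)" by simp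
    then have "(p, u) \<in> rtrancl_on W (arcs_on W)"
      using p' less.prems(2,4) by (intro less.hyps) auto
    moreover have "(w, p) \<in> arcs_on W" using p w \<open>p \<in> W\<close> by (simp add: arcs_on_def)
    ultimately show ?thesis using w by (blast intro: converse_rtrancl_on_into_rtrancl_on)
  qed
qed

lemma connected_T: "Digraph_Component.connected (with_proj T)"
proof -
  obtain r where r: "r \<in> V" "D r = E" using root_ex by auto
  have "(u, r) \<in> rtrancl_on V (arcs_on V)" if "u \<in> V" for u
    using that r D_subset by (intro rtrancl_on_ancestor) auto
  then have "(u, v) \<in> rtrancl_on V (arcs_on V)" if "u \<in> V" "v \<in> V" for u v
    using that by (blast intro: rtrancl_on_trans rtrancl_on_arcs_on_sym)
  moreover have "(arcs_ends (with_proj T))\<^sup>s = arcs_on V"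
    unfolding arcs_on_V by (auto simp: symcl_def)
  ultimately show ?thesis
    using r(1) by (auto simp: connected_conv)
qed

text \<open>At a vertex of a cycle with smallest set, both neighbours on the cycle must be its
  parent. Parents are unique, so the neighbours coincide, contradicting distinctness of the
  vertices.\<close>

lemma simple_tree_T: "simple_tree T"
proof -
  interpret pair_graph T by (rule pair_graph_T)
  have False if "cycle p" "3 \<le> length p" for p
  proof -
    obtain u where u: "set p \<subseteq> parcs T" "pcas u p u" "distinct (tl (pawalk_verts u p))" "p \<noteq> []"
      using \<open>cycle p\<close> by (auto simp: cycle_def awalk_def)
    have dist: "distinct (map snd p)" using u(3) pawalk_verts_conv[OF u(2)] by simp
    obtain a where a: "a \<in> set p" and min: "\<And>b. b \<in> set p \<Longrightarrow> card (D (snd a)) \<le> card (D (snd b))"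
      using u(4) ex_has_least_nat[of "\<lambda>a. a \<in> set p" "hd p" "\<lambda>a. card (D (snd a))"] by auto
    obtain p1 p2 where p: "p = p1 @ a # p2" using split_list[OF a] by blast
    \<comment> \<open>Two arcs besides \<open>a\<close> make the first arc \<open>b\<close> and the
      last arc \<open>c\<close> of the rest occupy different positions; this excludes the
      back-and-forth walk of length 2.\<close>
    have "Suc 1 \<le> length (p2 @ p1)" using \<open>3 \<le> length p\<close> p by simp
    then obtain b r' where b: "p2 @ p1 = b # r'" and "1 \<le> length r'"
      unfolding Suc_le_length_iff by blast
    then have "r' \<noteq> []" by auto
    then obtain q c where r': "r' = q @ [c]" by (metis rev_exhaust)
    \<comment> \<open>The cycle is rotated to start and end at the minimal vertex
      \<open>snd a\<close>, whose neighbours are then \<open>snd b\<close> and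
      \<open>snd c\<close>.\<close>
    have "pcas (snd a) (p2 @ p1 @ [a]) (snd a)"
      using u(2) unfolding p by (auto simp: pcas_append simp del: cas_append_iff)
    moreover have "p2 @ p1 @ [a] = b # q @ [c, a]" using b r' by (metis append.assoc append_Cons append_Nil)
    ultimately have "fst b = snd a" "fst a = snd c" by (auto simp: pcas_append simp del: cas_append_iff)
    have set: "set p = insert a (set (b # r'))" unfolding b[symmetric] p by auto
    have up: "parent (snd a) w" if "(snd a, w) \<in> parcs T" "card (D (snd a)) \<le> card (D w)" for w
    proof -
      have "\<not> parent w (snd a)"
        using that(2) psubset_card_mono[of "D (snd a)" "D w"] finite_D by (auto simp: parent_def)
      then show ?thesis using that(1) by simp
    qed
    have "b \<in> parcs T" "a \<in> parcs T" using u(1) set a by auto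
    then have "(snd a, snd b) \<in> parcs T" "(snd c, snd a) \<in> parcs T"
      using \<open>fst b = snd a\<close> \<open>fst a = snd c\<close> by (metis prod.collapse)+
    then have "parent (snd a) (snd b)" "parent (snd a) (snd c)"
      using min[of b] min[of c] set r' by (auto intro!: up)
    then have "snd b = snd c" by (rule parent_unique)
    moreover have "distinct (map snd (p2 @ p1))" using dist unfolding p by auto
    ultimately show False unfolding b r' by simp
  qed
  then show ?thesis
    using pair_graph_T connected_T unfolding simple_tree_def by blast
qed

text \<open>A singleton node has no child, and has a parent because \<open>E\<close> has at least
  two elements. Any other node has two children: one through an element \<open>x\<close>, another
  through an element outside the first child. This includes the root, which has no parent.\<close>

lemma tree_leaves_T: "tree_leaves T = \<sigma> ` E"
proof -
  interpret pair_graph T by (rule pair_graph_T)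
  have out: "out_degree (with_proj T) v = card {w. parent v w \<or> parent w v}" for v
  proof -
    have "out_arcs (with_proj T) v = Pair v ` {w. parent v w \<or> parent w v}"
      by (auto simp: out_arcs_def T_def)
    then show ?thesis by (simp add: out_degree_def card_image inj_on_def)
  qed
  have "out_degree (with_proj T) (\<sigma> x) = 1" if x: "x \<in> E" for x
  proof -
    have "D (\<sigma> x) \<noteq> E" using leaf(2)[OF x] card_E by auto
    then obtain p where p: "parent (\<sigma> x) p" using parent_ex leaf(1)[OF x] by blast
    have "\<not> parent w (\<sigma> x)" for w
      using leaf(2)[OF x] D_nonempty[of w] by (auto simp: parent_def)
    then have "{w. parent (\<sigma> x) w \<or> parent w (\<sigma> x)} = {p}"
      using p parent_unique by blast
    then show ?thesis by (simp add: out)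
  qed
  moreover have "v \<in> \<sigma> ` E" if v: "v \<in> V" "out_degree (with_proj T) v = 1" for v
  proof -
    obtain x where x: "x \<in> D v" using D_nonempty[OF v(1)] by blast
    have "D v = {x}"
    proof (rule ccontr)
      assume ne: "D v \<noteq> {x}"
      obtain c where c: "parent c v" "x \<in> D c" using child_ex[OF v(1) x ne] by blast
      then obtain y where y: "y \<in> D v" "y \<notin> D c" by (auto simp: parent_def)
      then have "D v \<noteq> {y}" using x c(2) by auto
      then obtain d where d: "parent d v" "y \<in> D d" using child_ex[OF v(1) y(1)] by blast
      have "c \<noteq> d" using y(2) d(2) by blast
      obtain z where "{w. parent v w \<or> parent w v} = {z}"
        using v(2) unfolding out by (meson card_1_singletonE)
      then have "c = z" "d = z" using c(1) d(1) by blast+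
      then show False using \<open>c \<noteq> d\<close> by simp
    qed
    moreover have "x \<in> E" using x D_subset[OF v(1)] by blast
    ultimately show ?thesis using D_eqD[of v "\<sigma> x"] leaf[of x] v(1) by auto
  qed
  ultimately show ?thesis
    using leaf(1) by (auto simp: tree_leaves_def)
qed

lemma bij_betw_\<sigma>: "bij_betw \<sigma> E (tree_leaves T)"
  unfolding tree_leaves_T bij_betw_def
  using leaf(2) by (auto intro!: inj_onI) (metis singleton_inject)

lemma internal_node_card:
  assumes "v \<in> internal_nodes T"
  shows "v \<in> V" "2 \<le> card (D v)"
proof -
  show v: "v \<in> V" using assms by (simp add: internal_nodes_def)
  have "card (D v) \<noteq> 1"
  proof
    assume "card (D v) = 1"
    then obtain x where x: "D v = {x}" by (rule card_1_singletonE)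
    then have "x \<in> E" using D_subset[OF v] by blast
    then have "v = \<sigma> x" using leaf[of x] x v by (intro D_eqD) auto
    then show False using assms \<open>x \<in> E\<close> tree_leaves_T by (auto simp: internal_nodes_def)
  qed
  moreover have "card (D v) \<noteq> 0" using finite_D[OF v] D_nonempty[OF v] by simp
  ultimately show "2 \<le> card (D v)" by linarith
qed

lemma internal_nodes_nonempty: "internal_nodes T \<noteq> {}"
proof -
  obtain r where r: "r \<in> V" "D r = E" using root_ex by auto
  have "r \<notin> \<sigma> ` E" using r(2) leaf(2) card_E by auto
  then show ?thesis using r(1) tree_leaves_T by (auto simp: internal_nodes_def)
qed

section \<open>Radius and width of the tree\<close>

text \<open>The number of sets strictly above a node drops when passing to its parent, so it bounds
  the depth of the node below the root.\<close>

lemma root_walk_ex: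
  assumes r: "r \<in> V" "D r = E" and "w \<in> V"
  shows "\<exists>p. pre_digraph.awalk (with_proj T) r p w \<and> length p \<le> card {z \<in> V. D w \<subset> D z}"
  using assms(3)
proof (induction "card {z \<in> V. D w \<subset> D z}" arbitrary: w rule: less_induct)
  case less
  interpret pair_graph T by (rule pair_graph_T)
  show ?case
  proof (cases "D w = E")
    case True
    then have "w = r" using r less.prems by (intro D_eqD) auto
    then have "awalk r [] w" using r(1) by (simp add: awalk_def)
    then show ?thesis by (intro exI[of _ "[]"]) simp
  next
    case False
    then obtain p where p: "parent w p" using parent_ex less.prems by blast
    then have p': "p \<in> V" "D w \<subset> D p" by (auto simp: parent_def)
    have lt: "card {z \<in> V. D p \<subset> D z} < card {z \<in> V. D w \<subset> D z}"
      using p' finite_V by (intro psubset_card_mono) auto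
    then obtain q where q: "awalk r q p" "length q \<le> card {z \<in> V. D p \<subset> D z}"
      using less.hyps[OF _ p'(1)] by blast
    have "awalk r (q @ [(p, w)]) w"
      using q(1) p by (auto simp: awalk_def pcas_append simp del: cas_append_iff)
    moreover have "length (q @ [(p, w)]) \<le> card {z \<in> V. D w \<subset> D z}" using q(2) lt by simp
    ultimately show ?thesis by blast
  qed
qed

lemma tree_radius_le:
  assumes "\<And>w. w \<in> V \<Longrightarrow> card {z \<in> V. D w \<subset> D z} \<le> k"
  shows "tree_radius T \<le> k"
proof -
  obtain r where r: "r \<in> V" "D r = E" using root_ex by auto
  have "node_dist T r w \<le> k" if w: "w \<in> V" for w
  proof -
    obtain p where p: "pre_digraph.awalk (with_proj T) r p w" "length p \<le> card {z \<in> V. D w \<subset> D z}"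
      using root_walk_ex[OF r w] by blast
    then have "node_dist T r w \<le> length p"
      unfolding node_dist_def by (intro Least_le) blast
    then show ?thesis using p(2) assms[OF w] by linarith
  qed
  then show ?thesis
    unfolding tree_radius_def using r(1) by (intro Least_le) auto
qed

text \<open>The arcs are symmetric, so a walk avoiding \<open>v\<close> gives reachability both
  ways, and a strong component contains every node mutually reachable with one of its own.\<close>

lemma sccs_verts_closed:
  assumes S: "S \<in> pre_digraph.sccs_verts (pre_digraph.del_vert (with_proj T) v)"
    and ab: "(a, b) \<in> rtrancl_on (V - {v}) (arcs_on (V - {v}))" and "a \<in> S"
  shows "b \<in> S"
proof -
  have "verts (pre_digraph.del_vert (with_proj T) v) = V - {v}"
    by (simp add: pre_digraph.verts_del_vert)
  moreover have "arcs_ends (pre_digraph.del_vert (with_proj T) v) = arcs_on (V - {v})"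
    by (auto simp: arcs_ends_conv pre_digraph.del_vert_simps arcs_on_def parent_def T_def)
  ultimately have "reachable (pre_digraph.del_vert (with_proj T) v) a b"
    "reachable (pre_digraph.del_vert (with_proj T) v) b a"
    using ab rtrancl_on_arcs_on_sym[OF ab] by (simp_all add: reachable_def)
  then show ?thesis using S \<open>a \<in> S\<close> unfolding pre_digraph.sccs_verts_def by blast
qed

text \<open>All leaves of a block can be joined in \<open>T - v\<close> to one common node: the root
  for \<open>E - D v\<close>, and \<open>c\<close> itself for a set \<open>D c\<close> strictly
  below \<open>D v\<close>. Hence each block lies in a single part.\<close>

lemma Union_node_partition_saturated:
  assumes M: "ground M = E" and v: "v \<in> V" and P: "\<P> \<subseteq> node_partition M T \<sigma> v"
  shows "saturated (insert (E - D v) {B \<in> D ` V. B \<subset> D v}) (\<Union> \<P>)"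
proof -
  have move: "f \<in> \<Union> \<P>" if "e \<in> \<Union> \<P>" "f \<in> E"
    and ef: "(\<sigma> e, u) \<in> rtrancl_on (V - {v}) (arcs_on (V - {v}))"
      "(\<sigma> f, u) \<in> rtrancl_on (V - {v}) (arcs_on (V - {v}))" for e f u
  proof -
    obtain S where S: "S \<in> pre_digraph.sccs_verts (pre_digraph.del_vert (with_proj T) v)"
      "{e \<in> ground M. \<sigma> e \<in> S} \<in> \<P>" "\<sigma> e \<in> S"
      using P \<open>e \<in> \<Union> \<P>\<close> unfolding node_partition_def by blast
    have "(\<sigma> e, \<sigma> f) \<in> rtrancl_on (V - {v}) (arcs_on (V - {v}))"
      using ef by (blast intro: rtrancl_on_trans rtrancl_on_arcs_on_sym)
    then have "\<sigma> f \<in> S" using sccs_verts_closed[OF S(1)] S(3) by blast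
    then show ?thesis using S(2) \<open>f \<in> E\<close> M by blast
  qed
  show ?thesis
    unfolding saturated_def
  proof
    fix B assume "B \<in> insert (E - D v) {B \<in> D ` V. B \<subset> D v}"
    then have "\<exists>u. \<forall>e\<in>B. e \<in> E \<and> (\<sigma> e, u) \<in> rtrancl_on (V - {v}) (arcs_on (V - {v}))"
    proof
      assume B: "B = E - D v"
      obtain r where r: "r \<in> V" "D r = E" using root_ex by auto
      \<comment> \<open>The climb avoids \<open>v\<close> because \<open>e \<notin> D v\<close>. If
        \<open>v\<close> is the root, \<open>B\<close> is empty and the claim is vacuous.\<close>
      have "(\<sigma> e, r) \<in> rtrancl_on (V - {v}) (arcs_on (V - {v}))" if "e \<in> B" for e
        using that B r leaf[of e] by (intro rtrancl_on_ancestor) auto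
      then show ?thesis using B by blast
    next
      assume "B \<in> {B \<in> D ` V. B \<subset> D v}"
      then obtain c where c: "c \<in> V" "B = D c" "D c \<subset> D v" by blast
      have "(\<sigma> e, c) \<in> rtrancl_on (V - {v}) (arcs_on (V - {v}))" if "e \<in> B" for e
        using that c leaf[of e] D_subset[OF c(1)] by (intro rtrancl_on_ancestor) auto
      then show ?thesis using c D_subset by blast
    qed
    then show "B \<subseteq> \<Union> \<P> \<or> B \<inter> \<Union> \<P> = {}" using move by blast
  qed
qed

lemma decomposition_width_le:
  assumes M: "ground M = E"
    and le: "\<And>v X. v \<in> V \<Longrightarrow> 2 \<le> card (D v) \<Longrightarrow> X \<subseteq> E \<Longrightarrow>
      saturated (insert (E - D v) {B \<in> D ` V. B \<subset> D v}) X \<Longrightarrow> conn_fun M X \<le> k"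
  shows "decomposition_width M T \<sigma> \<le> k"
proof -
  have "node_width M T \<sigma> v \<le> k" if v: "v \<in> internal_nodes T" for v
  proof -
    have "node_partition M T \<sigma> v \<subseteq> Pow (ground M)" by (auto simp: node_partition_def)
    then have fin: "finite (node_partition M T \<sigma> v)" by (rule finite_subset) simp
    have "conn_fun M (\<Union> \<P>) \<le> k" if P: "\<P> \<subseteq> node_partition M T \<sigma> v" for \<P>
    proof (rule le[OF internal_node_card[OF v]])
      show "\<Union> \<P> \<subseteq> E"
        using P \<open>node_partition M T \<sigma> v \<subseteq> Pow (ground M)\<close> M by blast
      show "saturated (insert (E - D v) {B \<in> D ` V. B \<subset> D v}) (\<Union> \<P>)"
        by (rule Union_node_partition_saturated[OF M internal_node_card(1)[OF v] P])
    qed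
    then show ?thesis
      unfolding node_width_def using fin by (intro Max.boundedI) auto
  qed
  moreover have "finite (internal_nodes T)" using finite_V by (simp add: internal_nodes_def)
  ultimately show ?thesis
    unfolding decomposition_width_def using internal_nodes_nonempty by (intro Max.boundedI) auto
qed

end
section \<open>Comparison of the depth parameters\<close>

lemma branch_depth_le_cdd: "branch_depth M \<le> contraction_deletion_depth M"
proof (cases "card (ground M) < 2")
  case True
  then show ?thesis by (simp add: branch_depth_def)
next
  case False
  define E where "E = ground M"
  define k where "k = contraction_deletion_depth M"
  obtain F where F: "decomposition_forest M k F"
    unfolding k_def using ex_decomposition_forest by blast
  note FD = decomposition_forestD[OF F, folded E_def]
  define G where "G = insert E F"
  have E_ne: "E \<noteq> {}" using False by (auto simp: E_def)
  have fin_F: "finite F" by (rule decomposition_forest_finite[OF F])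
  have G: "A \<subseteq> E" "A \<noteq> {}" if "A \<in> G" for A
    using that FD(1,2) E_ne by (auto simp: G_def)
  have "finite G" using fin_F by (simp add: G_def)
  \<comment> \<open>An arbitrary numbering of the finite family supplies the natural-number nodes;
    \<open>D\<close> inverts it.\<close>
  then obtain h :: "'a set \<Rightarrow> nat" where h: "inj_on h G"
    using finite_imp_inj_to_nat_seg[of G] by blast
  define V where "V = h ` G"
  define D where "D = inv_into G h"
  define \<sigma> where "\<sigma> x = h {x}" for x
  have Dh: "D (h A) = A" if "A \<in> G" for A
    using that h by (simp add: D_def)
  have DV: "D ` V = G" by (auto simp: V_def Dh image_image)
  interpret laminar_tree V D E \<sigma>
  proof
    show "finite V" using \<open>finite G\<close> by (simp add: V_def)
    show "finite E" "2 \<le> card E" using False by (simp_all add: E_def)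
    show "inj_on D V" unfolding D_def V_def by (rule inj_on_inv_into) simp
    have "laminar G"
      unfolding laminar_def
    proof (intro ballI)
      fix A B assume AB: "A \<in> G" "B \<in> G"
      then show "A \<subseteq> B \<or> B \<subseteq> A \<or> A \<inter> B = {}"
        using laminarD[OF FD(3), of A B] G(1)[OF AB(1)] G(1)[OF AB(2)] by (auto simp: G_def)
    qed
    then show "laminar (D ` V)" by (simp add: DV)
    show "E \<in> D ` V" unfolding DV by (simp add: G_def)
    fix v assume "v \<in> V"
    then have "D v \<in> G" using DV by blast
    then show "D v \<subseteq> E" "D v \<noteq> {}" by (rule G)+
  next
    fix x assume "x \<in> E"
    then have "{x} \<in> G" using FD(4) by (simp add: G_def)
    then show "\<sigma> x \<in> V" "D (\<sigma> x) = {x}" by (simp_all add: \<sigma>_def V_def Dh)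
  qed
  have "card {z \<in> V. D w \<subset> D z} \<le> k" if "w \<in> V" for w
  proof -
    define A where "A = D w"
    have A: "A \<in> G" using that DV by (auto simp: A_def)
    have "card {z \<in> V. D w \<subset> D z} = card (D ` {z \<in> V. D w \<subset> D z})"
      by (rule card_image[symmetric]) (rule inj_on_subset[OF inj_D], blast)
    also have "D ` {z \<in> V. D w \<subset> D z} = {B \<in> G. A \<subset> B}" by (auto simp: A_def simp flip: DV)
    also have "card {B \<in> G. A \<subset> B} \<le> k"
    proof (cases "A = E")
      case True
      then have none: "{B \<in> G. A \<subset> B} = {}" using G(1) by blast
      show ?thesis unfolding none by simp
    next
      case ne: False
      then have AF: "A \<in> F" using A by (simp add: G_def)
      have fin: "finite {B \<in> F. A \<subseteq> B}" using fin_F by simp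
      \<comment> \<open>The set \<open>A\<close> counts towards the height of \<open>F\<close> but
        not towards its own distance from the root; this makes room for the possibly new root
        \<open>E\<close>.\<close>
      have "{B \<in> G. A \<subset> B} \<subseteq> insert E ({B \<in> F. A \<subseteq> B} - {A})" by (auto simp: G_def)
      then have "card {B \<in> G. A \<subset> B} \<le> card (insert E ({B \<in> F. A \<subseteq> B} - {A}))"
        using fin by (intro card_mono) simp_all
      also have "\<dots> \<le> Suc (card ({B \<in> F. A \<subseteq> B} - {A}))"
        using fin by (simp only: card_insert_if finite_Diff split: if_split) simp
      also have "\<dots> = card {B \<in> F. A \<subseteq> B}"
        by (rule card_Suc_Diff1[OF fin]) (use AF in simp)
      also have "\<dots> \<le> k" by (rule FD(5)[OF AF])
      finally show ?thesis .
    qed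
    finally show ?thesis .
  qed
  then have radius: "tree_radius T \<le> k" by (rule tree_radius_le)
  have width: "decomposition_width M T \<sigma> \<le> k"
  proof (rule decomposition_width_le)
    show "ground M = E" by (simp add: E_def)
    fix v X
    assume v: "v \<in> V" "2 \<le> card (D v)" and X: "X \<subseteq> E"
      and sat: "saturated (insert (E - D v) {B \<in> D ` V. B \<subset> D v}) X"
    have "D v \<in> G" using v(1) DV by blast
    then consider "D v \<in> F" | "D v = E" "E \<notin> F" by (auto simp: G_def)
    then show "conn_fun M X \<le> k"
    proof cases
      case 1
      have "saturated (insert (E - D v) {B \<in> F. B \<subset> D v}) X"
        by (rule saturated_mono[OF sat]) (auto simp: DV G_def)
      then show ?thesis by (rule FD(6)[OF 1 v(2) X])
    next
      case 2
      \<comment> \<open>At a newly added root the parts come from the whole of \<open>F\<close>, so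
        \<lambda> vanishes there by the root condition.\<close>
      have "B \<subset> E" if "B \<in> F" for B using FD(1)[OF that] 2(2) that by blast
      then have "saturated F X"
        by (intro saturated_mono[OF sat]) (auto simp: DV G_def 2(1))
      then show ?thesis using FD(7)[OF X] by simp
    qed
  qed
  have "decomposition M T \<sigma>"
    unfolding decomposition_def E_def[symmetric]
    using simple_tree_T internal_nodes_nonempty bij_betw_\<sigma> by blast
  with radius width have "\<exists>(T :: nat pair_pre_digraph) \<sigma>.
      decomposition M T \<sigma> \<and> decomposition_width M T \<sigma> \<le> k \<and> tree_radius T \<le> k"
    by blast
  then show ?thesis
    using False unfolding branch_depth_def k_def[symmetric] by (auto intro: Least_le)
qed

theorem theorem5p2:
  fixes M :: "'a matroid"
  shows "branch_depth M \<le> contraction_deletion_depth M \<and>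
    contraction_deletion_depth M \<le> min (contraction_depth M) (deletion_depth M)"
  by (simp add: branch_depth_le_cdd cdd_le_cd cdd_le_dd)

end
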